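(* Let $X$ be an infinite-dimensional complex Banach space, $T\in L(X)$, and let $\mathbf R$ be one of $\mathcal B_+$, $\mathcal B_-$, $\mathcal B$, $\Phi_+$, $\Phi_-$, $\Phi$, $\mathcal W_+$, $\mathcal W_-$, $\mathcal W$. If $0\in\partial\sigma_{\mathbf R}(T)$ and $T$ admits a GKRD, then $0\in\operatorname{iso}\sigma_{\mathbf R}(T)$. Moreover, if $T$ admits a GKRD, then: $0\in\partial\sigma_{ap}(T)$ implies $0\notin\operatorname{acc}\sigma_{\mathcal B_+}(T)$; $0\in\partial\sigma_{su}(T)$ implies $0\notin\operatorname{acc}\sigma_{\mathcal B_-}(T)$; and $0\in\partial\sigma(T)$ implies $0\notin\operatorname{acc}\sigma_{\mathcal B}(T)$.
   Context: $S$ is Kato if $R(S)$ is closed and $N(S)\subset R(S^n)$ for all $n$; $S$ is Riesz if $S-\lambda$ is Fredholm for all $\lambda\ne0$; $T$ admits a GKRD if there are closed $T$-invariant $M,N$ with $X=M\oplus N$, $T_M$ Kato, $T_N$ Riesz. $\Phi_+$: finite-dimensional kernel and closed range; $\Phi_-$: finite-codimensional range; $\Phi=\Phi_+\cap\Phi_-$; $\mathcal W_+$, $\mathcal W_-$, $\mathcal W$: operators in $\Phi_+$, $\Phi_-$, $\Phi$ with index $\le0$, $\ge0$, $=0$; $\mathcal B_+$: $\Phi_+$ with finite ascent; $\mathcal B_-$: $\Phi_-$ with finite descent; $\mathcal B$: Fredholm with finite ascent and descent. $\sigma_{\mathbf R}(T)=\{\lambda:T-\lambda\notin\mathbf R\}$;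 $\sigma_{ap}(T)$ ($\sigma_{su}(T)$) is the set of $\lambda$ with $T-\lambda$ not bounded below (not surjective). $\partial$, $\operatorname{iso}$, $\operatorname{acc}$ denote boundary, isolated points, accumulation points. *)

theory Defs
  imports "HOL-Analysis.Analysis"
begin

text \<open>A complex Banach space is modelled as a real Banach space 'a together with a
  complex scalar multiplication scl extending the real one and compatible with the norm.\<close>

definition complex_structure :: "(complex \<Rightarrow> 'a::real_normed_vector \<Rightarrow> 'a) \<Rightarrow> bool" where
  "complex_structure scl \<longleftrightarrow>
     (\<forall>r x. scl (complex_of_real r) x = r *\<^sub>R x) \<and>
     (\<forall>a b x. scl (a * b) x = scl a (scl b x)) \<and>
     (\<forall>a x y. scl a (x + y) = scl a x + scl a y) \<and>
     (\<forall>a b x. scl (a + b) x = scl a x + scl b x) \<and>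
     (\<forall>a x. norm (scl a x) = cmod a * norm x)"

definition infinite_dimensional :: "'a::real_vector itself \<Rightarrow> bool" where
  "infinite_dimensional _ \<longleftrightarrow> \<not> (\<exists>B::'a set. finite B \<and> span B = UNIV)"

definition is_op :: "(complex \<Rightarrow> 'a::real_normed_vector \<Rightarrow> 'a) \<Rightarrow> ('a \<Rightarrow> 'a) \<Rightarrow> bool" where
  "is_op scl S \<longleftrightarrow> bounded_linear S \<and> (\<forall>c x. S (scl c x) = scl c (S x))"

definition csubspace :: "(complex \<Rightarrow> 'a::real_vector \<Rightarrow> 'a) \<Rightarrow> 'a set \<Rightarrow> bool" where
  "csubspace scl V \<longleftrightarrow> subspace V \<and> (\<forall>c. \<forall>x\<in>V. scl c x \<in> V)"

definition shift :: "(complex \<Rightarrow> 'a::real_vector \<Rightarrow> 'a) \<Rightarrow> ('a \<Rightarrow> 'a) \<Rightarrow> complex \<Rightarrow> 'a \<Rightarrow> 'a" where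
  "shift scl S \<mu> = (\<lambda>x. S x - scl \<mu> x)"

definition ker :: "('a \<Rightarrow> 'b::zero) \<Rightarrow> 'a set" where
  "ker S = {x. S x = 0}"

definition fin_dim :: "'a::real_vector set \<Rightarrow> bool" where
  "fin_dim V \<longleftrightarrow> (\<exists>B. finite B \<and> V \<subseteq> span B)"

definition fin_codim :: "'a::real_vector set \<Rightarrow> bool" where
  "fin_codim V \<longleftrightarrow> (\<exists>F. finite F \<and> span (V \<union> F) = UNIV)"

definition codim :: "'a::real_vector set \<Rightarrow> nat" where
  "codim V = (LEAST n. \<exists>F. finite F \<and> card F = n \<and> span (V \<union> F) = UNIV)"

definition upper_semi_fredholm :: "('a::real_normed_vector \<Rightarrow> 'a) \<Rightarrow> bool" where
  "upper_semi_fredholm S \<longleftrightarrow> fin_dim (ker S) \<and> closed (range S)"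

definition lower_semi_fredholm :: "('a::real_normed_vector \<Rightarrow> 'a) \<Rightarrow> bool" where
  "lower_semi_fredholm S \<longleftrightarrow> fin_codim (range S)"

definition fredholm :: "('a::real_normed_vector \<Rightarrow> 'a) \<Rightarrow> bool" where
  "fredholm S \<longleftrightarrow> upper_semi_fredholm S \<and> lower_semi_fredholm S"

text \<open>Sign conditions on the index ind S = dim N(S) - codim R(S) (possibly infinite).
  Real dimensions are twice the complex ones, so the sign/zero conditions are unchanged.\<close>
definition weyl_upper :: "('a::real_normed_vector \<Rightarrow> 'a) \<Rightarrow> bool" where
  "weyl_upper S \<longleftrightarrow> upper_semi_fredholm S \<and>
     (fin_codim (range S) \<longrightarrow> dim (ker S) \<le> codim (range S))"

definition weyl_lower :: "('a::real_normed_vector \<Rightarrow> 'a) \<Rightarrow> bool" where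
  "weyl_lower S \<longleftrightarrow> lower_semi_fredholm S \<and>
     (fin_dim (ker S) \<longrightarrow> codim (range S) \<le> dim (ker S))"

definition weyl :: "('a::real_normed_vector \<Rightarrow> 'a) \<Rightarrow> bool" where
  "weyl S \<longleftrightarrow> fredholm S \<and> dim (ker S) = codim (range S)"

definition finite_ascent :: "('a \<Rightarrow> 'a::zero) \<Rightarrow> bool" where
  "finite_ascent S \<longleftrightarrow> (\<exists>p. ker (S ^^ p) = ker (S ^^ Suc p))"

definition finite_descent :: "('a \<Rightarrow> 'a) \<Rightarrow> bool" where
  "finite_descent S \<longleftrightarrow> (\<exists>q. range (S ^^ q) = range (S ^^ Suc q))"

definition browder_upper :: "('a::real_normed_vector \<Rightarrow> 'a) \<Rightarrow> bool" where
  "browder_upper S \<longleftrightarrow> upper_semi_fredholm S \<and> finite_ascent S"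

definition browder_lower :: "('a::real_normed_vector \<Rightarrow> 'a) \<Rightarrow> bool" where
  "browder_lower S \<longleftrightarrow> lower_semi_fredholm S \<and> finite_descent S"

definition browder :: "('a::real_normed_vector \<Rightarrow> 'a) \<Rightarrow> bool" where
  "browder S \<longleftrightarrow> fredholm S \<and> finite_ascent S \<and> finite_descent S"

datatype op_class = B_plus | B_minus | B_class | Phi_plus | Phi_minus | Phi_class
  | W_plus | W_minus | W_class

fun in_class :: "op_class \<Rightarrow> ('a::real_normed_vector \<Rightarrow> 'a) \<Rightarrow> bool" where
  "in_class B_plus S = browder_upper S"
| "in_class B_minus S = browder_lower S"
| "in_class B_class S = browder S"
| "in_class Phi_plus S = upper_semi_fredholm S"
| "in_class Phi_minus S = lower_semi_fredholm S"
| "in_class Phi_class S = fredholm S"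
| "in_class W_plus S = weyl_upper S"
| "in_class W_minus S = weyl_lower S"
| "in_class W_class S = weyl S"

definition spec_R :: "op_class \<Rightarrow> (complex \<Rightarrow> 'a::real_normed_vector \<Rightarrow> 'a) \<Rightarrow> ('a \<Rightarrow> 'a) \<Rightarrow> complex set" where
  "spec_R R scl T = {\<mu>. \<not> in_class R (shift scl T \<mu>)}"

definition bounded_below :: "('a::real_normed_vector \<Rightarrow> 'a) \<Rightarrow> bool" where
  "bounded_below S \<longleftrightarrow> (\<exists>c>0. \<forall>x. c * norm x \<le> norm (S x))"

definition spectrum :: "(complex \<Rightarrow> 'a::real_normed_vector \<Rightarrow> 'a) \<Rightarrow> ('a \<Rightarrow> 'a) \<Rightarrow> complex set" where
  "spectrum scl T = {\<mu>. \<not> bij (shift scl T \<mu>)}"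

definition spec_ap :: "(complex \<Rightarrow> 'a::real_normed_vector \<Rightarrow> 'a) \<Rightarrow> ('a \<Rightarrow> 'a) \<Rightarrow> complex set" where
  "spec_ap scl T = {\<mu>. \<not> bounded_below (shift scl T \<mu>)}"

definition spec_su :: "(complex \<Rightarrow> 'a::real_normed_vector \<Rightarrow> 'a) \<Rightarrow> ('a \<Rightarrow> 'a) \<Rightarrow> complex set" where
  "spec_su scl T = {\<mu>. \<not> surj (shift scl T \<mu>)}"

definition kato_on :: "'a::real_normed_vector set \<Rightarrow> ('a \<Rightarrow> 'a) \<Rightarrow> bool" where
  "kato_on M T \<longleftrightarrow> closed (T ` M) \<and> (\<forall>n. {x\<in>M. T x = 0} \<subseteq> (T ^^ n) ` M)"

definition fredholm_on :: "'a::real_normed_vector set \<Rightarrow> ('a \<Rightarrow> 'a) \<Rightarrow> bool" where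
  "fredholm_on N S \<longleftrightarrow> fin_dim {x\<in>N. S x = 0} \<and> closed (S ` N) \<and>
     (\<exists>F. finite F \<and> F \<subseteq> N \<and> N \<subseteq> span (S ` N \<union> F))"

definition riesz_on :: "(complex \<Rightarrow> 'a::real_normed_vector \<Rightarrow> 'a) \<Rightarrow> 'a set \<Rightarrow> ('a \<Rightarrow> 'a) \<Rightarrow> bool" where
  "riesz_on scl N T \<longleftrightarrow> (\<forall>\<mu>. \<mu> \<noteq> 0 \<longrightarrow> fredholm_on N (shift scl T \<mu>))"

definition GKRD :: "(complex \<Rightarrow> 'a::real_normed_vector \<Rightarrow> 'a) \<Rightarrow> ('a \<Rightarrow> 'a) \<Rightarrow> bool" where
  "GKRD scl T \<longleftrightarrow> (\<exists>M N. closed M \<and> closed N \<and> csubspace scl M \<and> csubspace scl N \<and>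
     T ` M \<subseteq> M \<and> T ` N \<subseteq> N \<and> M \<inter> N = {0} \<and> (\<forall>x. \<exists>m\<in>M. \<exists>n\<in>N. x = m + n) \<and>
     kato_on M T \<and> riesz_on scl N T)"

definition iso_pts :: "'b::topological_space set \<Rightarrow> 'b set" where
  "iso_pts S = {x\<in>S. \<not> x islimpt S}"

definition acc_pts :: "'b::topological_space set \<Rightarrow> 'b set" where
  "acc_pts S = {x. x islimpt S}"

end

theory Submission
  imports Defs
begin

text \<open>
  Write \<open>X = M \<oplus> N\<close> as in the GKRD. For a Kato operator the core \<open>K = \<Inter>n. T\<^sup>n M\<close> is closed and
  \<open>T\<close> maps it onto itself; it follows that the reduced minimum modulus of \<open>T - \<lambda>\<close> on \<open>M\<close> is bounded
  below for \<open>\<lambda>\<close> near \<open>0\<close>. Hence kernels and ranges of \<open>T - \<lambda>\<close> on \<open>M\<close> vary with small gap, so nullity and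
  defect are constant on a disc; a Kato operator of finite ascent (descent) is injective
  (surjective). On \<open>N\<close> every \<open>T - \<lambda>\<close> with \<open>\<lambda> \<noteq> 0\<close> is Browder of index zero: the closure of
  the set of \<open>\<lambda> \<noteq> 0\<close> for which \<open>T - \<lambda>\<close> is bijective is open and closed in the connected set \<open>\<complex> - {0}\<close>.
  So for small \<open>\<lambda> \<noteq> 0\<close> membership of \<open>T - \<lambda>\<close> in each class depends only on the constant nullity and
  defect on \<open>M\<close>, and one \<open>\<lambda>\<close> in the disc outside the spectrum decides the whole punctured disc.
  In case that one \<open>\<lambda>\<close> is \<open>0\<close>, the index condition still passes to \<open>M\<close>, because a semi-Fredholm
  limit of bijective operators \<open>T - \<mu>\<close> on \<open>N\<close> has index zero too.
\<close>

section \<open>Relative dimension\<close>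

text \<open>Nullity and defect may be infinite, while a gap estimate controls only finitely many
  dimensions: the perturbation that \<open>k\<close> independent vectors survive shrinks like
  \<open>(1/5) ^ k\<close>. No single radius obtained this way serves all \<open>k\<close>. The
  radius of the disc is therefore fixed beforehand by the bound on the modulus, the assertion that a
  dimension is at least \<open>k\<close> is carried across this disc in steps whose length depends
  on \<open>k\<close>, and dimensions are compared level by level. On \<open>N\<close> the delicate
  point is that the closure of the bijective shifts is open. At a point \<mu> of it other than 0 the
  operator \<open>T - \<mu>\<close> is Fredholm but need not be Kato. Its restriction to the range
  of a suitable power is Kato, bijective shifts close to \<mu> restrict to bijections of this range,
  and constancy of nullity and defect makes all shifts near \<mu> bijective there. The vectors
  killed by that power do no harm to the shifts other than \<open>T - \<mu>\<close>, because
  \<open>T - \<mu>\<close> is nilpotent on them.\<close>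

lemma enat_leI_all_nat:
  assumes "\<And>k. enat k \<le> a \<Longrightarrow> enat k \<le> b"
  shows "a \<le> b"
proof (cases a)
  case (enat n)
  then show ?thesis using assms[of n] by simp
next
  case infinity
  show ?thesis
  proof (cases b)
    case (enat m)
    then show ?thesis using assms[of "Suc m"] infinity by simp
  qed simp
qed

lemma enat_eqI_le:
  assumes "\<And>k. enat k \<le> a \<longleftrightarrow> enat k \<le> b"
  shows "a = b"
proof (rule antisym)
  show "a \<le> b" by (rule enat_leI_all_nat) (simp only: assms)
  show "b \<le> a" by (rule enat_leI_all_nat) (simp only: assms)
qed

lemma enat_le_finite: "a \<le> b \<Longrightarrow> b \<noteq> \<infinity> \<Longrightarrow> a \<noteq> (\<infinity>::enat)"
  by (cases a; cases b) auto

lemma enat_sequence_attains_min: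
  fixes f :: "nat \<Rightarrow> enat"
  shows "\<exists>p. \<forall>n. f p \<le> f n"
proof -
  have "(LEAST x. x \<in> range f) \<in> range f" by (rule LeastI[of _ "f 0"]) simp
  then obtain p where "(LEAST x. x \<in> range f) = f p" by blast
  then show ?thesis using Least_le[of "\<lambda>x. x \<in> range f"] by (metis rangeI)
qed

text \<open>\<open>rdim V U\<close> is the dimension of \<open>U/V\<close> for subspaces \<open>V \<subseteq> U\<close>, and \<open>\<infinity>\<close> if no finite \<open>F\<close> exists. Nullity
  and defect are the cases \<open>V = {0}\<close> and \<open>V\<close> a range, so both are covered by one theory.\<close>

definition rdim :: "'a::real_vector set \<Rightarrow> 'a set \<Rightarrow> enat" where
  "rdim V U = (INF F\<in>{F. finite F \<and> F \<subseteq> U \<and> U \<subseteq> span (V \<union> F)}. enat (card F))"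

lemma rdim_le_card:
  "finite F \<Longrightarrow> F \<subseteq> U \<Longrightarrow> U \<subseteq> span (V \<union> F) \<Longrightarrow> rdim V U \<le> card F"
  unfolding rdim_def by (rule INF_lower) auto

lemma le_rdimI:
  "(\<And>F. finite F \<Longrightarrow> F \<subseteq> U \<Longrightarrow> U \<subseteq> span (V \<union> F) \<Longrightarrow> c \<le> enat (card F)) \<Longrightarrow> c \<le> rdim V U"
  unfolding rdim_def by (rule INF_greatest) auto

lemma rdim_attained:
  assumes "rdim V U \<noteq> \<infinity>"
  obtains F where "finite F" "F \<subseteq> U" "U \<subseteq> span (V \<union> F)" "rdim V U = card F"
proof -
  let ?A = "(\<lambda>F. enat (card F)) ` {F. finite F \<and> F \<subseteq> U \<and> U \<subseteq> span (V \<union> F)}"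
  have "?A \<noteq> {}" using assms unfolding rdim_def by (metis Inf_empty top_enat_def)
  then have "Inf ?A \<in> ?A" by (auto simp: Inf_enat_def intro: LeastI)
  then show ?thesis using that unfolding rdim_def by auto
qed

lemma span_finite_support:
  assumes "finite C" "C \<subseteq> span S"
  obtains S0 where "finite S0" "S0 \<subseteq> S" "C \<subseteq> span S0"
proof -
  have "\<forall>c\<in>C. \<exists>t. finite t \<and> t \<subseteq> S \<and> c \<in> span t"
  proof
    fix c assume "c \<in> C"
    then obtain t r where "finite t" "t \<subseteq> S" "c = (\<Sum>a\<in>t. r a *\<^sub>R a)"
      using assms(2) unfolding span_explicit[of S] by blast
    then have "finite t \<and> t \<subseteq> S \<and> c \<in> span t" by (auto intro: span_sum span_scale span_base)
    then show "\<exists>t. finite t \<and> t \<subseteq> S \<and> c \<in> span t" by blast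
  qed
  then obtain t where t: "\<And>c. c \<in> C \<Longrightarrow> finite (t c) \<and> t c \<subseteq> S \<and> c \<in> span (t c)" by metis
  have "C \<subseteq> span (\<Union>c\<in>C. t c)"
  proof
    fix c assume "c \<in> C"
    then have "span (t c) \<subseteq> span (\<Union>c\<in>C. t c)" by (intro span_mono) auto
    then show "c \<in> span (\<Union>c\<in>C. t c)" using t \<open>c \<in> C\<close> by auto
  qed
  then show ?thesis using t assms(1) by (intro that[of "\<Union>c\<in>C. t c"]) auto
qed

text \<open>The exchange lemma is applied to \<open>C \<union> B0\<close> inside
  \<open>span (B0 \<union> F)\<close>, and the common part \<open>B0\<close> is cancelled. Quotient
  dimensions become counts of basis vectors, so that additivity reduces to disjoint unions.\<close>

lemma rdim_eq_card_basis:
  assumes "B \<subseteq> D" "independent D" "span B = V" "span D = U"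
  shows "rdim V U = (if finite (D - B) then enat (card (D - B)) else \<infinity>)"
proof -
  have VU: "span (V \<union> F) = span (B \<union> F)" for F
    using assms(3) by (simp only: span_Un span_span flip: assms(3))
  have bd: "card C \<le> card F" if F: "finite F" "U \<subseteq> span (V \<union> F)" and C: "finite C" "C \<subseteq> D - B" for F C
  proof -
    have "C \<subseteq> span (B \<union> F)"
      using C F assms VU by (metis Diff_subset dual_order.trans span_superset)
    \<comment> \<open>\<open>V\<close> may be infinite dimensional. Only the finitely many elements
      of \<open>B\<close> that express \<open>C\<close> are kept, which gives the exchange argument
      a finite spanning set.\<close>
    then obtain S0 where S0: "finite S0" "S0 \<subseteq> B \<union> F" "C \<subseteq> span S0"
      using span_finite_support C by blast
    define B0 where "B0 = S0 \<inter> B"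
    have "C \<union> B0 \<subseteq> span (B0 \<union> F)"
    proof -
      have "span S0 \<subseteq> span (B0 \<union> F)" using S0 by (intro span_mono) (auto simp: B0_def)
      then show ?thesis using S0 by (auto simp: span_base)
    qed
    moreover have "independent (C \<union> B0)"
      by (rule independent_mono[OF assms(2)]) (use assms(1) C in \<open>auto simp: B0_def\<close>)
    ultimately have "card (C \<union> B0) \<le> card (B0 \<union> F)"
      using independent_span_bound[of "B0 \<union> F" "C \<union> B0"] S0 F by (auto simp: B0_def)
    moreover have "card (C \<union> B0) = card C + card B0"
      using C S0 by (intro card_Un_disjoint) (auto simp: B0_def)
    moreover have "card (B0 \<union> F) \<le> card B0 + card F" by (rule card_Un_le)
    ultimately show ?thesis by linarith
  qed
  have le: "enat (card (D - B)) \<le> card F \<and> finite (D - B)" if "finite F" "U \<subseteq> span (V \<union> F)" for F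
  proof -
    have "finite (D - B) \<and> card (D - B) \<le> card F"
      by (rule finite_if_finite_subsets_card_bdd) (use bd[OF that] in auto)
    then show ?thesis by simp
  qed
  show ?thesis
  proof (cases "finite (D - B)")
    case True
    have "U \<subseteq> span (V \<union> (D - B))"
      using assms(1,4) VU by (simp add: Un_absorb1)
    moreover have "D - B \<subseteq> U" using assms(4) span_superset by blast
    ultimately have "rdim V U \<le> card (D - B)" using True by (intro rdim_le_card) auto
    moreover have "enat (card (D - B)) \<le> rdim V U" using le by (intro le_rdimI) auto
    ultimately show ?thesis using True by auto
  next
    case False
    have "rdim V U = \<infinity>"
    proof (rule ccontr)
      assume "rdim V U \<noteq> \<infinity>"
      then obtain F where "finite F" "U \<subseteq> span (V \<union> F)" by (rule rdim_attained)
      then show False using le False by blast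
    qed
    then show ?thesis using False by auto
  qed
qed

lemma rdim_basis_exists:
  assumes "subspace V" "subspace U" "V \<subseteq> U"
  obtains B D where "B \<subseteq> D" "independent D" "span B = V" "span D = U"
proof -
  obtain B where B: "B \<subseteq> V" "independent B" "V \<subseteq> span B" using maximal_independent_subset by blast
  obtain D where D: "B \<subseteq> D" "D \<subseteq> U" "independent D" "U \<subseteq> span D"
    using maximal_independent_subset_extend[of B U] B assms by blast
  show ?thesis using that[of B D] B D assms by (metis span_subspace)
qed

text \<open>Nested bases \<open>B \<subseteq> C \<subseteq> D\<close> are counted. The identity
  holds in \<open>enat\<close>, so it can be invoked before it is known which of its terms are
  finite.\<close>

lemma rdim_chain:
  assumes "subspace V" "subspace U" "subspace W" "V \<subseteq> U" "U \<subseteq> W"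
  shows "rdim V W = rdim V U + rdim U W"
proof -
  obtain B C where B: "B \<subseteq> C" "independent C" "span B = V" "span C = U"
    using rdim_basis_exists assms by metis
  have "C \<subseteq> W" using B assms span_superset by blast
  then obtain D where D: "C \<subseteq> D" "D \<subseteq> W" "independent D" "W \<subseteq> span D"
    using maximal_independent_subset_extend[of C W] B assms by blast
  have sD: "span D = W" using D assms by (metis span_subspace)
  have eq: "D - B = (C - B) \<union> (D - C)" using B D by auto
  have dis: "(C - B) \<inter> (D - C) = {}" by auto
  have "card (D - B) = card (C - B) + card (D - C)" if "finite (C - B)" "finite (D - C)"
    unfolding eq using that dis by (rule card_Un_disjoint)
  then show ?thesis
    using rdim_eq_card_basis[of B D V W] rdim_eq_card_basis[of B C V U] rdim_eq_card_basis[of C D U W]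
      B D sD eq by auto
qed

lemma rdim_mono_right: "subspace V \<Longrightarrow> subspace U \<Longrightarrow> subspace W \<Longrightarrow> V \<subseteq> U \<Longrightarrow> U \<subseteq> W \<Longrightarrow> rdim V U \<le> rdim V W"
  by (simp add: rdim_chain[of V U W])

lemma rdim_eq_0_iff:
  assumes "subspace V"
  shows "rdim V U = 0 \<longleftrightarrow> U \<subseteq> V"
proof
  assume "rdim V U = 0"
  then obtain F where "finite F" "U \<subseteq> span (V \<union> F)" "0 = enat (card F)"
    using rdim_attained[of V U] by (metis infinity_ne_i0)
  then show "U \<subseteq> V" using span_eq_iff[of V] assms by (metis card_0_eq enat_0_iff(1) sup_bot_right)
next
  assume "U \<subseteq> V"
  then have "rdim V U \<le> card ({}::'a set)"
    by (intro rdim_le_card) (auto intro: span_base)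
  then show "rdim V U = 0" by (simp add: zero_enat_def[symmetric])
qed

lemma rdim_self [simp]: "subspace V \<Longrightarrow> rdim V V = 0"
  by (simp add: rdim_eq_0_iff)

lemma rdim_image_le:
  assumes "linear f"
  shows "rdim (f ` V) (f ` U) \<le> rdim V U"
proof (rule le_rdimI)
  fix F assume F: "finite F" "F \<subseteq> U" "U \<subseteq> span (V \<union> F)"
  have "f ` U \<subseteq> f ` span (V \<union> F)" using F by auto
  also have "\<dots> = span (f ` V \<union> f ` F)"
    using assms by (metis linear_span_image image_Un)
  finally have "rdim (f ` V) (f ` U) \<le> card (f ` F)" using F by (intro rdim_le_card) auto
  also have "\<dots> \<le> card F" using F by (simp add: card_image_le)
  finally show "rdim (f ` V) (f ` U) \<le> card F" by simp
qed

text \<open>As the kernel of \<open>f\<close> on \<open>U\<close> lies in \<open>V\<close>, the map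
  induced on the quotients is injective. One preimage in \<open>U\<close> per spanning vector keeps
  the cardinality.\<close>

lemma rdim_image:
  assumes f: "linear f" and U: "subspace U" and V: "subspace V" "V \<subseteq> U"
    and ker: "\<And>x. x \<in> U \<Longrightarrow> f x = 0 \<Longrightarrow> x \<in> V"
  shows "rdim (f ` V) (f ` U) = rdim V U"
proof (rule antisym[OF rdim_image_le[OF f]])
  show "rdim V U \<le> rdim (f ` V) (f ` U)"
  proof (rule le_rdimI)
    fix F assume F: "finite F" "F \<subseteq> f ` U" "f ` U \<subseteq> span (f ` V \<union> F)"
    obtain G where G: "G \<subseteq> U" "finite G" "f ` G = F" "card G = card F"
      using F(1,2) subset_image_inj[of F f U] by (metis card_image finite_imageD)
    have "U \<subseteq> span (V \<union> G)"
    proof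
      fix u assume u: "u \<in> U"
      then have "f u \<in> f ` span (V \<union> G)"
        using F(3) G(3) linear_span_image[OF f, of "V \<union> G"] by (auto simp: image_Un)
      then obtain w where w: "w \<in> span (V \<union> G)" "f u = f w" by auto
      have "w \<in> U" using w(1) span_minimal[of "V \<union> G" U] G V U by auto
      then have "u - w \<in> V" using ker[of "u - w"] u U w f by (simp add: subspace_diff linear_diff)
      then have "u - w \<in> span (V \<union> G)" by (simp add: span_base)
      then show "u \<in> span (V \<union> G)" using w(1) by (metis span_add diff_add_cancel)
    qed
    then have "rdim V U \<le> card G" using G by (intro rdim_le_card)
    then show "rdim V U \<le> card F" using G by simp
  qed
qed

abbreviation ssum :: "'a::real_vector set \<Rightarrow> 'a set \<Rightarrow> 'a set" where
  "ssum A B \<equiv> {x + y |x y. x \<in> A \<and> y \<in> B}"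

lemma independent_Un:
  fixes A B :: "'a::real_vector set"
  assumes "independent A" "independent B" "span A \<inter> span B = {0}"
  shows "independent (A \<union> B)" "A \<inter> B = {}"
proof -
  have z: "x \<in> span A \<Longrightarrow> x \<in> span B \<Longrightarrow> x = 0" for x using assms(3) by auto
  have nz: "0 \<notin> A" "0 \<notin> B" using assms dependent_zero by blast+
  show dis: "A \<inter> B = {}" using z nz by (auto dest: span_base)
  \<comment> \<open>The variables \<open>A'\<close> and \<open>B'\<close> let one argument serve
    with the two sets exchanged.\<close>
  have main: "a \<notin> span (A' \<union> B' - {a})"
    if *: "independent A'" "\<And>x. x \<in> span A' \<Longrightarrow> x \<in> span B' \<Longrightarrow> x = 0" "a \<in> A'" "a \<notin> B'" for A' B' :: "'a set" and a
  proof
    assume "a \<in> span (A' \<union> B' - {a})"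
    then have "a \<in> span ((A' - {a}) \<union> B')" using \<open>a \<notin> B'\<close> by (simp add: Un_Diff)
    then obtain x y where xy: "a = x + y" "x \<in> span (A' - {a})" "y \<in> span B'" unfolding span_Un by auto
    have "x \<in> span A'" using xy(2) span_mono[of "A' - {a}" A'] by auto
    then have "y \<in> span A'" using xy(1) * span_diff[of a A' x] by (simp add: span_base)
    then have "y = 0" using * xy by auto
    then show False using xy * by (simp add: dependent_def)
  qed
  show "independent (A \<union> B)"
    unfolding dependent_def
  proof
    assume "\<exists>a\<in>A \<union> B. a \<in> span (A \<union> B - {a})"
    then obtain a where a: "a \<in> A \<union> B" "a \<in> span (A \<union> B - {a})" by blast
    show False
    proof (cases "a \<in> A")
      case True
      then have "a \<notin> B" using dis by auto
      then show False using main[OF assms(1) z True] a(2) by simp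
    next
      case False
      then have "a \<in> B" using a by simp
      then show False using main[OF assms(2) z, of A a] False a(2) by (simp add: Un_commute)
    qed
  qed
qed

text \<open>Since \<open>U1\<close> and \<open>U2\<close> meet only in 0, the union of their bases
  is a basis of the sum. This is what splits nullity and defect along a direct
  decomposition.\<close>

lemma rdim_ssum:
  assumes "subspace V1" "subspace U1" "V1 \<subseteq> U1" "subspace V2" "subspace U2" "V2 \<subseteq> U2"
    "U1 \<inter> U2 = {0}"
  shows "rdim (ssum V1 V2) (ssum U1 U2) = rdim V1 U1 + rdim V2 U2"
proof -
  obtain B1 D1 where 1: "B1 \<subseteq> D1" "independent D1" "span B1 = V1" "span D1 = U1"
    using rdim_basis_exists assms by metis
  obtain B2 D2 where 2: "B2 \<subseteq> D2" "independent D2" "span B2 = V2" "span D2 = U2"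
    using rdim_basis_exists assms by metis
  have D: "independent (D1 \<union> D2)" "D1 \<inter> D2 = {}"
    using independent_Un[of D1 D2] 1 2 assms by auto
  have eq: "(D1 \<union> D2) - (B1 \<union> B2) = (D1 - B1) \<union> (D2 - B2)" using D(2) 1 2 by auto
  have "card ((D1 - B1) \<union> (D2 - B2)) = card (D1 - B1) + card (D2 - B2)"
    if "finite (D1 - B1)" "finite (D2 - B2)"
    using that D(2) by (intro card_Un_disjoint) auto
  moreover have "span (B1 \<union> B2) = ssum V1 V2" "span (D1 \<union> D2) = ssum U1 U2"
    unfolding span_Un using 1 2 by auto
  ultimately show ?thesis
    using rdim_eq_card_basis[of "B1 \<union> B2" "D1 \<union> D2" "ssum V1 V2" "ssum U1 U2"]
      rdim_eq_card_basis[OF 1] rdim_eq_card_basis[OF 2] D 1(1) 2(1) unfolding eq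
    by (simp add: le_supI1 le_supI2)
qed

text \<open>Each new vector strictly enlarges the span over \<open>V\<close>, so every link of the
  chain contributes at least 1.\<close>

lemma le_rdim_if_free:
  assumes "subspace V" "subspace U" "V \<subseteq> U"
    and x: "\<And>i. i < k \<Longrightarrow> x i \<in> U \<and> x i \<notin> span (V \<union> x ` {..<i})"
  shows "enat k \<le> rdim V U"
proof -
  let ?V = "\<lambda>i. span (V \<union> x ` {..<i})"
  have "enat i \<le> rdim V (?V i)" if "i \<le> k" for i
    using that
  proof (induction i)
    case (Suc i)
    have sub: "V \<subseteq> ?V i" "?V i \<subseteq> ?V (Suc i)"
      using span_superset[of "V \<union> x ` {..<i}"] by (auto intro!: span_mono)
    have "x i \<in> ?V (Suc i)" by (auto intro: span_base)
    then have "rdim (?V i) (?V (Suc i)) \<noteq> 0" using x[of i] Suc.prems by (auto simp: rdim_eq_0_iff)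
    then have "1 \<le> rdim (?V i) (?V (Suc i))" by (simp add: ileI1 one_eSuc)
    then have "enat i + 1 \<le> rdim V (?V i) + rdim (?V i) (?V (Suc i))"
      using Suc by (intro add_mono) auto
    also have "\<dots> = rdim V (?V (Suc i))"
      using sub assms by (intro rdim_chain[symmetric]) auto
    finally show ?case by (simp add: plus_1_eSuc eSuc_enat one_enat_def)
  qed (simp add: zero_enat_def[symmetric])
  then have "enat k \<le> rdim V (?V k)" by simp
  also have "\<dots> \<le> rdim V U"
  proof (rule rdim_mono_right)
    show "V \<subseteq> ?V k" using span_superset[of "V \<union> x ` {..<k}"] by auto
    show "?V k \<subseteq> U" using assms by (intro span_minimal) auto
  qed (use assms in auto)
  finally show ?thesis .
qed

text \<open>\<open>fin_dim\<close> permits spanning vectors outside \<open>V\<close>, whereas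
  \<open>rdim\<close> draws them from \<open>V\<close>. A maximal independent subset of
  \<open>V\<close>, finite by the exchange lemma, bridges the two.\<close>

lemma fin_dim_iff_rdim:
  assumes "subspace V" shows "fin_dim V \<longleftrightarrow> rdim {0} V \<noteq> \<infinity>"
proof
  assume "fin_dim V"
  then obtain B where B: "finite B" "V \<subseteq> span B" by (auto simp: fin_dim_def)
  obtain C where C: "C \<subseteq> V" "independent C" "V \<subseteq> span C" using maximal_independent_subset by blast
  have "finite C" using independent_span_bound[of B C] B C by auto
  then have "rdim {0} V \<le> card C" using C by (intro rdim_le_card) auto
  then have "rdim {0} V < \<infinity>" using enat_ord_code(4) le_less_trans by blast
  then show "rdim {0} V \<noteq> \<infinity>" by auto
next
  assume "rdim {0} V \<noteq> \<infinity>"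
  then obtain F where "finite F" "V \<subseteq> span ({0} \<union> F)" by (rule rdim_attained)
  then show "fin_dim V" unfolding fin_dim_def by (intro exI[of _ F]) simp
qed

lemma rdim_eq_dim:
  assumes "subspace V" "rdim {0} V \<noteq> \<infinity>" shows "rdim {0} V = dim V"
proof -
  obtain C where C: "C \<subseteq> V" "independent C" "V \<subseteq> span C" using maximal_independent_subset by blast
  have "span C = V" using C assms by (metis span_subspace)
  then show ?thesis
    using rdim_eq_card_basis[of "{}" C "{0}" V] C dim_eq_card[of C V] assms(2)
    by (auto simp: span_span split: if_splits)
qed

lemma fin_codim_iff_rdim: "fin_codim V \<longleftrightarrow> rdim V UNIV \<noteq> \<infinity>"
proof
  assume "fin_codim V"
  then obtain F where "finite F" "span (V \<union> F) = UNIV" by (auto simp: fin_codim_def)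
  then have "rdim V UNIV \<le> card F" by (intro rdim_le_card) auto
  then have "rdim V UNIV < \<infinity>" using enat_ord_code(4) le_less_trans by blast
  then show "rdim V UNIV \<noteq> \<infinity>" by auto
next
  assume "rdim V UNIV \<noteq> \<infinity>"
  then obtain F where "finite F" "UNIV \<subseteq> span (V \<union> F)" by (rule rdim_attained)
  then show "fin_codim V" by (auto simp: fin_codim_def)
qed

text \<open>\<open>codim\<close> is a \<open>LEAST\<close>, unspecified if no finite
  \<open>F\<close> exists; hence the finiteness hypothesis.\<close>

lemma rdim_eq_codim:
  assumes "rdim V UNIV \<noteq> \<infinity>" shows "rdim V UNIV = codim V"
proof -
  obtain F where F: "finite F" "UNIV \<subseteq> span (V \<union> F)" "rdim V UNIV = card F"
    using assms by (rule rdim_attained)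
  have "codim V = card F"
    unfolding codim_def
  proof (rule Least_equality)
    show "\<exists>G. finite G \<and> card G = card F \<and> span (V \<union> G) = UNIV" using F by auto
    fix n assume "\<exists>G. finite G \<and> card G = n \<and> span (V \<union> G) = UNIV"
    then obtain G where G: "finite G" "card G = n" "span (V \<union> G) = UNIV" by auto
    then have "rdim V UNIV \<le> card G" by (intro rdim_le_card) auto
    then show "card F \<le> n" using F G by simp
  qed
  then show ?thesis using F by simp
qed

section \<open>Closed subspaces of Banach spaces\<close>

text \<open>Each residual has at most half the norm of its predecessor, so the corrections are
  dominated by a geometric series and sum up inside the complete space \<open>V\<close>; the
  telescoping residuals show that the sum solves the equation. The open mapping theorem, the
  perturbation of surjections, the closedness of ranges and the Neumann series are all
  instances.\<close>

lemma approximately_onto_imp_onto: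
  fixes f :: "'a::banach \<Rightarrow> 'b::real_normed_vector"
  assumes f: "bounded_linear f" and V: "subspace V" "closed V" and W: "subspace W"
    and "c \<ge> 0" and fV: "\<And>x. x \<in> V \<Longrightarrow> f x \<in> W"
    and ap: "\<And>y. y \<in> W \<Longrightarrow> \<exists>x\<in>V. norm x \<le> c * norm y \<and> norm (y - f x) \<le> norm y / 2"
    and y: "y \<in> W"
  shows "\<exists>x\<in>V. f x = y \<and> norm x \<le> 2 * c * norm y"
proof -
  interpret f: bounded_linear f by fact
  obtain g where g: "\<And>y. y \<in> W \<Longrightarrow> g y \<in> V \<and> norm (g y) \<le> c * norm y \<and> norm (y - f (g y)) \<le> norm y / 2"
    using ap by metis
  \<comment> \<open>\<open>r n\<close> is the error left after \<open>n\<close> corrections.\<close>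
  define r where "r n = ((\<lambda>y. y - f (g y)) ^^ n) y" for n
  have r0: "r 0 = y" and rS: "r (Suc n) = r n - f (g (r n))" for n by (auto simp: r_def)
  have rW: "r n \<in> W" for n
    by (induction n) (use y g fV W in \<open>auto simp: r0 rS subspace_diff\<close>)
  have rn: "norm (r n) \<le> norm y * (1/2) ^ n" for n
  proof (induction n)
    case (Suc n)
    have "norm (r (Suc n)) \<le> norm (r n) / 2" using g[OF rW[of n]] by (simp add: rS)
    then show ?case using Suc by simp
  qed (simp add: r0)
  have gn: "norm (g (r n)) \<le> c * norm y * (1/2) ^ n" for n
  proof -
    have "norm (g (r n)) \<le> c * norm (r n)" using g[OF rW] by blast
    also have "\<dots> \<le> c * (norm y * (1/2) ^ n)" using rn \<open>c \<ge> 0\<close> by (intro mult_left_mono)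
    finally show ?thesis by (simp add: mult.assoc)
  qed
  have sm: "summable (\<lambda>n. c * norm y * (1/2::real) ^ n)" by (intro summable_mult summable_geometric) simp
  define x where "x = (\<Sum>n. g (r n))"
  have sg: "(\<lambda>n. g (r n)) sums x"
    unfolding x_def using summable_comparison_test'[OF sm gn] by (rule summable_sums)
  have "norm x \<le> (\<Sum>n. c * norm y * (1/2::real) ^ n)"
    unfolding x_def using gn sm by (rule norm_suminf_le)
  also have "\<dots> = c * norm y * 2"
    by (subst suminf_mult) (auto simp: suminf_geometric summable_geometric)
  finally have nx: "norm x \<le> 2 * c * norm y" by simp
  have "r \<longlonglongrightarrow> 0"
  proof (rule Lim_null_comparison)
    show "\<forall>\<^sub>F n in sequentially. norm (r n) \<le> norm y * (1/2) ^ n" using rn by simp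
    show "(\<lambda>n. norm y * (1/2) ^ n) \<longlonglongrightarrow> 0"
      using tendsto_mult_right_zero[OF LIMSEQ_power_zero[of "1/2::real"]] by simp
  qed
  then have "(\<lambda>n. r n - r (Suc n)) sums (r 0 - 0)" by (rule telescope_sums')
  then have "(\<lambda>n. f (g (r n))) sums y" by (simp add: r0 rS)
  moreover have "(\<lambda>n. f (g (r n))) sums f x" using sg by (rule f.sums)
  ultimately have "f x = y" by (rule sums_unique2[symmetric])
  moreover have "x \<in> V"
  proof (rule closed_sequentially[OF V(2)])
    show "(\<lambda>n. \<Sum>i<n. g (r i)) \<longlonglongrightarrow> x" using sg by (simp add: sums_def)
    show "(\<Sum>i<n. g (r i)) \<in> V" for n using V(1) g rW by (intro subspace_sum) auto
  qed
  ultimately show ?thesis using nx by blast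
qed

lemma subspace_closure:
  fixes V :: "'b::real_normed_vector set"
  assumes V: "subspace V"
  shows "subspace (closure V)"
  unfolding subspace_def
proof (intro conjI ballI allI)
  show "0 \<in> closure V" using closure_subset subspace_0[OF V] by (rule subsetD)
  fix x y c assume x: "x \<in> closure V"
  then obtain u where u: "\<And>n. u n \<in> V" "u \<longlonglongrightarrow> x" unfolding closure_sequential by blast
  show "c *\<^sub>R x \<in> closure V"
    unfolding closure_sequential
    using u V by (intro exI[of _ "\<lambda>n. c *\<^sub>R u n"]) (auto intro: tendsto_intros subspace_scale)
  assume "y \<in> closure V"
  then obtain v where "\<And>n. v n \<in> V" "v \<longlonglongrightarrow> y" unfolding closure_sequential by blast
  then show "x + y \<in> closure V"
    unfolding closure_sequential
    using u V by (intro exI[of _ "\<lambda>n. u n + v n"]) (auto intro: tendsto_intros subspace_add)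
qed

lemma open_mapping_closed_subspace:
  fixes f :: "'a::banach \<Rightarrow> 'b::banach"
  assumes f: "bounded_linear f" and V: "subspace V" "closed V" and clo: "closed (f ` V)"
  obtains c where "c > 0" "\<And>y. y \<in> f ` V \<Longrightarrow> \<exists>x\<in>V. f x = y \<and> norm x \<le> c * norm y"
proof -
  interpret f: bounded_linear f by fact
  let ?W = "f ` V"
  have W: "subspace ?W" using V(1) f.linear_axioms by (simp add: linear_subspace_image)
  define C where "C n = closure (f ` (V \<inter> cball 0 (real n)))" for n
  have CW: "C n \<subseteq> ?W" for n unfolding C_def using clo by (intro closure_minimal) auto
  have cover: "?W = \<Union> (range C)"
  proof
    show "?W \<subseteq> \<Union> (range C)"
    proof
      fix y assume "y \<in> ?W"
      then obtain x where x: "x \<in> V" "y = f x" by auto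
      obtain n where "norm x \<le> real n" using real_arch_simple by blast
      then have "y \<in> C n" using x closure_subset unfolding C_def by fastforce
      then show "y \<in> \<Union> (range C)" by auto
    qed
  qed (use CW in auto)
  have "\<exists>n. top_of_set ?W interior_of C n \<noteq> {}"
  proof (rule ccontr)
    assume "\<not> ?thesis"
    moreover have "closedin (top_of_set ?W) (C n)" for n
      using CW by (intro closed_subset) (auto simp: C_def)
    moreover have "completely_metrizable_space (top_of_set ?W)"
      using clo closed_closedin completely_metrizable_space_closedin completely_metrizable_space_euclidean by blast
    ultimately have "top_of_set ?W interior_of \<Union> (range C) = {}"
      by (intro Baire_category_alt) auto
    moreover have "top_of_set ?W interior_of ?W = ?W"
      using interior_of_topspace[of "top_of_set ?W"] by simp
    ultimately have "?W = {}" using cover by simp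
    then show False using V(1) subspace_0 by blast
  qed
  then obtain n y0 where "y0 \<in> top_of_set ?W interior_of C n" by blast
  then obtain O' where O': "openin (top_of_set ?W) O'" "y0 \<in> O'" "O' \<subseteq> C n"
    unfolding interior_of_def by blast
  then obtain e where e: "e > 0" "ball y0 e \<inter> ?W \<subseteq> C n" "y0 \<in> ?W"
    unfolding openin_contains_ball by blast
  have approx: "\<exists>x\<in>V. norm x \<le> 2 * n \<and> norm (y - f x) < d" if y: "y \<in> ?W" "norm y < e" and d: "d > 0" for y d
  proof -
    have "y0 + y \<in> ball y0 e \<inter> ?W" "y0 \<in> ball y0 e \<inter> ?W"
      using y e W by (auto simp: dist_norm subspace_add simp del: image_iff)
    then have "y0 + y \<in> C n" "y0 \<in> C n" using e by auto
    then have "\<exists>z\<in>f ` (V \<inter> cball 0 (real n)). dist z (y0 + y) < d/2"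
      "\<exists>z\<in>f ` (V \<inter> cball 0 (real n)). dist z y0 < d/2"
      using d unfolding C_def closure_approachable by (meson half_gt_zero)+
    then obtain x1 x2 where x: "x1 \<in> V" "norm x1 \<le> n" "dist (f x1) (y0 + y) < d/2"
       "x2 \<in> V" "norm x2 \<le> n" "dist (f x2) y0 < d/2" by auto
    have "y - f (x1 - x2) = (f x2 - y0) - (f x1 - (y0 + y))" by (simp add: f.diff)
    then have "norm (y - f (x1 - x2)) \<le> norm (f x2 - y0) + norm (f x1 - (y0 + y))"
      by (metis norm_triangle_ineq4)
    then have "norm (y - f (x1 - x2)) < d" using x by (simp add: dist_norm)
    moreover have "norm (x1 - x2) \<le> 2 * n" using x norm_triangle_ineq4[of x1 x2] by linarith
    ultimately show ?thesis using x V(1) by (intro bexI[of _ "x1 - x2"]) (auto simp: subspace_diff)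
  qed
  \<comment> \<open>A multiple of \<open>y\<close> of norm \<open>e / 2\<close> has an approximate
    preimage of norm at most \<open>2 * n\<close>; the quotient is \<open>4 * n / e\<close>.\<close>
  define c where "c = 4 * real n / e"
  have c0: "c \<ge> 0" using e by (simp add: c_def)
  have "\<exists>x\<in>V. norm x \<le> c * norm y \<and> norm (y - f x) \<le> norm y / 2" if y: "y \<in> ?W" for y
  proof (cases "y = 0")
    case True
    then show ?thesis using V(1) by (intro bexI[of _ 0]) (auto simp: subspace_0 f.zero)
  next
    case False
    define t where "t = e / (2 * norm y)"
    have t: "t > 0" using e False by (simp add: t_def)
    have "t *\<^sub>R y \<in> ?W" using W y by (rule subspace_scale)
    moreover have "norm (t *\<^sub>R y) < e" using t e False by (simp add: t_def)
    ultimately obtain x where x: "x \<in> V" "norm x \<le> 2 * n" "norm (t *\<^sub>R y - f x) < t * norm y / 2"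
      using approx[of "t *\<^sub>R y" "t * norm y / 2"] t False by auto
    have "norm (x /\<^sub>R t) \<le> 2 * n / t" using x t by (simp add: divide_simps)
    also have "\<dots> = c * norm y" using e False by (simp add: c_def t_def)
    finally have 1: "norm (x /\<^sub>R t) \<le> c * norm y" .
    have "y - f (x /\<^sub>R t) = (t *\<^sub>R y - f x) /\<^sub>R t" using t by (simp add: f.scaleR algebra_simps)
    then have "norm (y - f (x /\<^sub>R t)) = norm (t *\<^sub>R y - f x) / t" using t by (simp add: divide_inverse mult.commute)
    also have "\<dots> \<le> norm y / 2" using x(3) t by (simp add: divide_simps) (simp add: mult.commute)
    finally show ?thesis using 1 x(1) V(1) by (intro bexI[of _ "x /\<^sub>R t"]) (auto simp: subspace_scale)
  qed
  then have main: "\<exists>x\<in>V. f x = y \<and> norm x \<le> 2 * c * norm y" if "y \<in> ?W" for y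
    using approximately_onto_imp_onto[OF f V W c0 _ _ that] by blast
  show ?thesis
  proof (rule that[of "2 * c + 1"])
    \<comment> \<open>\<open>c\<close> is 0 if \<open>n\<close> is 0; adding 1 makes the constant
      strictly positive.\<close>
    show "2 * c + 1 > 0" using c0 by simp
    fix y assume "y \<in> ?W"
    then obtain x where "x \<in> V" "f x = y" "norm x \<le> 2 * c * norm y" using main by blast
    moreover have "2 * c * norm y \<le> (2 * c + 1) * norm y" by (simp add: algebra_simps)
    ultimately show "\<exists>x\<in>V. f x = y \<and> norm x \<le> (2 * c + 1) * norm y"
      by (intro bexI[of _ x]) auto
  qed
qed

section \<open>Closedness of sums and of images\<close>

lemma distance_to_closed_subspace:
  fixes V :: "'a::real_normed_vector set"
  assumes V: "subspace V" "closed V" and x: "x \<notin> V"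
  shows "infdist x V > 0" "v \<in> V \<Longrightarrow> \<bar>t\<bar> * infdist x V \<le> norm (t *\<^sub>R x - v)"
proof -
  show "infdist x V > 0"
    using V x subspace_0 by (intro infdist_pos_not_in_closed) auto
  assume v: "v \<in> V"
  show "\<bar>t\<bar> * infdist x V \<le> norm (t *\<^sub>R x - v)"
  proof (cases "t = 0")
    case False
    have "infdist x V \<le> dist x (v /\<^sub>R t)" using V v by (intro infdist_le) (simp add: subspace_scale)
    then have "\<bar>t\<bar> * infdist x V \<le> \<bar>t\<bar> * norm (x - v /\<^sub>R t)" by (simp add: dist_norm mult_left_mono)
    also have "\<dots> = norm (t *\<^sub>R (x - v /\<^sub>R t))" by simp
    also have "t *\<^sub>R (x - v /\<^sub>R t) = t *\<^sub>R x - v" using False by (simp add: algebra_simps)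
    finally show ?thesis .
  qed simp
qed

text \<open>The distance from \<open>x\<close> to \<open>V\<close> is positive, so along a
  convergent sequence the coefficients of \<open>x\<close> are Cauchy. Subtracting their limit
  leaves a limit of vectors of the closed \<open>V\<close>.\<close>

lemma closed_span_insert:
  fixes V :: "'a::real_normed_vector set"
  assumes V: "subspace V" "closed V"
  shows "closed (span (insert x V))"
proof (cases "x \<in> V")
  case True
  then have "span (insert x V) = V" using V by (simp add: insert_absorb)
  then show ?thesis using V by simp
next
  case False
  let ?d = "infdist x V"
  have sV: "span V = V" using V by simp
  note d = distance_to_closed_subspace[OF V False]
  show ?thesis
    unfolding closed_sequential_limits
  proof (intro allI impI)
    fix y l assume y: "(\<forall>n. y n \<in> span (insert x V)) \<and> y \<longlonglongrightarrow> l"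
    then have "\<forall>n. \<exists>k. y n - k *\<^sub>R x \<in> V" unfolding span_insert sV by simp
    then obtain k where k: "\<And>n. y n - k n *\<^sub>R x \<in> V" by metis
    have kk: "\<bar>k n - k m\<bar> * ?d \<le> dist (y n) (y m)" for n m
    proof -
      have "(y m - k m *\<^sub>R x) - (y n - k n *\<^sub>R x) \<in> V" by (rule subspace_diff[OF V(1) k k])
      from d(2)[OF this, of "k n - k m"]
      have "\<bar>k n - k m\<bar> * ?d \<le> norm ((k n - k m) *\<^sub>R x - ((y m - k m *\<^sub>R x) - (y n - k n *\<^sub>R x)))" .
      also have "(k n - k m) *\<^sub>R x - ((y m - k m *\<^sub>R x) - (y n - k n *\<^sub>R x)) = y n - y m"
        by (simp add: algebra_simps)
      finally show ?thesis by (simp add: dist_norm)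
    qed
    have "Cauchy k"
    proof (rule metric_CauchyI)
      fix e :: real assume "e > 0"
      then have "e * ?d > 0" using d by simp
      moreover have "Cauchy y" using y LIMSEQ_imp_Cauchy by blast
      ultimately obtain M where M: "\<And>m n. m \<ge> M \<Longrightarrow> n \<ge> M \<Longrightarrow> dist (y m) (y n) < e * ?d"
        unfolding Cauchy_def by meson
      have "dist (k m) (k n) < e" if "m \<ge> M" "n \<ge> M" for m n
      proof -
        have "\<bar>k m - k n\<bar> * ?d < e * ?d" using kk[of m n] M[OF that] by linarith
        then show ?thesis using d(1) by (simp add: dist_real_def)
      qed
      then show "\<exists>M. \<forall>m\<ge>M. \<forall>n\<ge>M. dist (k m) (k n) < e" by blast
    qed
    then obtain k0 where "k \<longlonglongrightarrow> k0" using Cauchy_convergent convergent_def by blast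
    then have "(\<lambda>n. y n - k n *\<^sub>R x) \<longlonglongrightarrow> l - k0 *\<^sub>R x" using y by (intro tendsto_intros) auto
    then have "l - k0 *\<^sub>R x \<in> V" by (rule closed_sequentially[OF V(2) k])
    then show "l \<in> span (insert x V)" unfolding span_insert sV by auto
  qed
qed

lemma closed_span_Un_finite:
  fixes V :: "'a::real_normed_vector set"
  assumes "finite F" and V: "subspace V" "closed V"
  shows "closed (span (V \<union> F))"
  using assms(1)
proof induction
  case empty
  have "span V = V" using V by simp
  then show ?case using V by (metis Un_empty_right)
next
  case (insert x F)
  have "span (V \<union> insert x F) = span (insert x (span (V \<union> F)))"
    by (simp add: span_insert span_span)
  then show ?case using closed_span_insert[of "span (V \<union> F)" x] insert by simp
qed

text \<open>Let \<open>f (v n)\<close> tend to \<open>f x\<close>. The open mapping bound on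
  \<open>N\<close> lifts the differences to vectors \<open>z n\<close> tending to 0, and
  \<open>x + z n\<close> differs from \<open>v n\<close> by a kernel vector, hence lies in
  \<open>V\<close>. So \<open>x\<close> is a limit of vectors of \<open>V\<close>.\<close>

lemma closed_image_containing_kernel:
  fixes f :: "'a::banach \<Rightarrow> 'b::banach"
  assumes f: "bounded_linear f" and N: "subspace N" "closed N" "closed (f ` N)"
    and V: "subspace V" "closed V" "V \<subseteq> N" and ker: "\<And>x. x \<in> N \<Longrightarrow> f x = 0 \<Longrightarrow> x \<in> V"
  shows "closed (f ` V)"
proof -
  interpret f: bounded_linear f by fact
  obtain c where c: "c > 0" "\<And>y. y \<in> f ` N \<Longrightarrow> \<exists>x\<in>N. f x = y \<and> norm x \<le> c * norm y"
    using open_mapping_closed_subspace[OF f N] by blast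
  show ?thesis
    unfolding closed_sequential_limits
  proof (intro allI impI)
    fix y l assume y: "(\<forall>n. y n \<in> f ` V) \<and> y \<longlonglongrightarrow> l"
    have "y n \<in> f ` N" for n using y V(3) by (meson image_mono subsetD)
    then have "l \<in> f ` N" using closed_sequentially[OF N(3)] y by metis
    then obtain x where x: "x \<in> N" "l = f x" by auto
    have "\<exists>v\<in>V. y n = f v" for n using spec[OF conjunct1[OF y], of n] by (rule imageE) blast
    then obtain v where v: "\<And>n. v n \<in> V" "\<And>n. y n = f (v n)" by metis
    have "f (v n - x) \<in> f ` N" for n
      by (intro imageI subspace_diff[OF N(1) subsetD[OF V(3) v(1)] x(1)])
    then have "\<exists>z\<in>N. f z = f (v n - x) \<and> norm z \<le> c * norm (f (v n - x))" for n by (rule c(2))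
    then obtain z where z: "\<And>n. z n \<in> N" "\<And>n. f (z n) = f (v n - x)" "\<And>n. norm (z n) \<le> c * norm (f (v n - x))"
      by metis
    have "x + z n \<in> V" for n
    proof -
      have "f (x + z n - v n) = 0" using z(2)[of n] by (simp add: f.add f.diff)
      moreover have "x + z n - v n \<in> N"
        by (rule subspace_diff[OF N(1) subspace_add[OF N(1) x(1) z(1)] subsetD[OF V(3) v(1)]])
      ultimately have "x + z n - v n \<in> V" by (rule ker[rotated])
      from subspace_add[OF V(1) this v(1)[of n]] show ?thesis by simp
    qed
    moreover have lim: "(\<lambda>n. x + z n) \<longlonglongrightarrow> x + 0"
    proof (intro tendsto_add tendsto_const Lim_null_comparison[of z])
      show "\<forall>\<^sub>F n in sequentially. norm (z n) \<le> c * norm (y n - l)"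
        using z(3) by (simp add: v(2) x(2) f.diff)
      have "(\<lambda>n. c * norm (y n - l)) \<longlonglongrightarrow> c * norm (l - l)"
        using y by (intro tendsto_intros) auto
      then show "(\<lambda>n. c * norm (y n - l)) \<longlonglongrightarrow> 0" by simp
    qed
    ultimately have "x + 0 \<in> V" by (intro closed_sequentially[OF V(2) _ lim])
    then have "x \<in> V" by simp
    then show "l \<in> f ` V" using x by auto
  qed
qed

lemma independent_span_disjoint:
  fixes B F :: "'a::real_vector set"
  assumes "independent (B \<union> F)" "B \<inter> F = {}" "x \<in> span B" "x \<in> span F"
  shows "x = 0"
proof -
  obtain g :: "'a \<Rightarrow> 'a" where g: "linear g" "\<And>x. x \<in> B \<union> F \<Longrightarrow> g x = (if x \<in> B then x else 0)"
    using linear_independent_extend[OF assms(1), of "\<lambda>x. if x \<in> B then x else 0"] by blast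
  have "g x = x" by (rule linear_eq_on[OF g(1) linear_id[unfolded id_def] assms(3)]) (simp add: g(2))
  moreover have "g x = 0"
    by (rule linear_eq_on[OF g(1) linear_zero assms(4)]) (use g(2) assms(2) in auto)
  ultimately show ?thesis by simp
qed

text \<open>For a finite-dimensional complement \<open>G\<close> of the range,
  \<open>(x, g) \<mapsto> f x + g\<close> is open from \<open>N \<times> G\<close> onto
  \<open>N\<close>. If \<open>y n\<close> in the range tends to \<open>l\<close>, the component of
  \<open>l\<close> in \<open>G\<close> is bounded by a multiple of \<open>norm (l - y n)\<close> and
  so vanishes.\<close>

lemma closed_image_of_finite_codim:
  fixes f :: "'a::banach \<Rightarrow> 'a"
  assumes f: "bounded_linear f" and N: "subspace N" "closed N" "f ` N \<subseteq> N"
    and fin: "rdim (f ` N) N \<noteq> \<infinity>"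
  shows "closed (f ` N)"
proof -
  interpret f: bounded_linear f by fact
  have sub: "subspace (f ` N)" using N f.linear_axioms by (simp add: linear_subspace_image)
  obtain B D where BD: "B \<subseteq> D" "independent D" "span B = f ` N" "span D = N"
    using rdim_basis_exists[OF sub N(1,3)] by blast
  define F where "F = D - B"
  have finF: "finite F" using fin rdim_eq_card_basis[OF BD] by (auto simp: F_def split: if_splits)
  define G where "G = span F"
  have DBF: "D = B \<union> F" using BD by (auto simp: F_def)
  have GN: "G \<subseteq> N" using BD unfolding G_def F_def by (metis Diff_subset span_mono)
  have zero: "g = 0" if "g \<in> f ` N" "g \<in> G" for g
  proof (rule independent_span_disjoint)
    show "independent (B \<union> F)" using BD(2) unfolding DBF .
    show "B \<inter> F = {}" by (auto simp: F_def)
    show "g \<in> span B" "g \<in> span F" using that BD(3) by (simp_all add: G_def)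
  qed
  have clG: "closed G" using closed_span_Un_finite[OF finF, of "{0}"] by (simp add: G_def)
  let ?h = "\<lambda>p. f (fst p) + snd p"
  have h: "bounded_linear ?h"
    by (intro bounded_linear_add bounded_linear_compose[OF f] bounded_linear_fst bounded_linear_snd)
  have hN: "?h ` (N \<times> G) = N"
  proof
    show "?h ` (N \<times> G) \<subseteq> N" using N GN by (auto intro!: subspace_add)
    show "N \<subseteq> ?h ` (N \<times> G)"
    proof
      fix y assume "y \<in> N"
      then have "y \<in> span (B \<union> F)" using BD(4) unfolding DBF by simp
      then obtain b g where "y = b + g" "b \<in> span B" "g \<in> G" unfolding span_Un G_def by auto
      then obtain x where "x \<in> N" "y = f x + g" using BD by auto
      then show "y \<in> ?h ` (N \<times> G)" using \<open>g \<in> G\<close> by force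
    qed
  qed
  have "subspace (N \<times> G)" "closed (N \<times> G)"
    using N(1,2) clG by (simp_all add: subspace_Times closed_Times G_def)
  from open_mapping_closed_subspace[OF h this] N(2)
  obtain c where c: "c > 0" "\<And>y. y \<in> N \<Longrightarrow> \<exists>p\<in>N \<times> G. ?h p = y \<and> norm p \<le> c * norm y"
    unfolding hN by blast
  show ?thesis
    unfolding closed_sequential_limits
  proof (intro allI impI)
    fix y l assume y: "(\<forall>n. y n \<in> f ` N) \<and> y \<longlonglongrightarrow> l"
    have yN: "y n \<in> N" for n using y N(3) by (meson subsetD)
    then have l: "l \<in> N" using closed_sequentially[OF N(2)] y by metis
    then have "l \<in> ?h ` (N \<times> G)" unfolding hN .
    then obtain x g where xg: "x \<in> N" "g \<in> G" "l = f x + g" by auto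
    have "norm g \<le> c * norm (l - y n)" for n
    proof -
      have "l - y n \<in> N" by (rule subspace_diff[OF N(1) l yN])
      then obtain z g' where z: "z \<in> N" "g' \<in> G" "f z + g' = l - y n" "norm (z, g') \<le> c * norm (l - y n)"
        using c(2)[of "l - y n"] by auto
      obtain w where w: "w \<in> N" "y n = f w" using spec[OF conjunct1[OF y], of n] by (rule imageE) blast
      have "g - g' = f (z + w - x)" using z(3) w xg by (simp add: f.add f.diff algebra_simps)
      moreover have "z + w - x \<in> N" using z w xg N by (auto intro: subspace_add subspace_diff)
      ultimately have "g - g' \<in> f ` N" by blast
      moreover have "g - g' \<in> G" using xg(2) z(2) by (simp add: G_def span_diff)
      ultimately have "g - g' = 0" by (rule zero)
      then have "norm g \<le> norm (z, g')" using norm_snd_le[of g' z] by simp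
      then show ?thesis using z by linarith
    qed
    moreover have "(\<lambda>n. c * norm (l - y n)) \<longlonglongrightarrow> c * norm (l - l)"
      using y by (intro tendsto_intros) auto
    ultimately have "norm g \<le> 0" by (intro LIMSEQ_le_const[of "\<lambda>n. c * norm (l - y n)"]) auto
    then show "l \<in> f ` N" using xg by auto
  qed
qed

section \<open>Relative dimension under small gaps\<close>

lemma span_image_lessThan:
  assumes "y \<in> span (V \<union> x ` {..<n::nat})" and V: "subspace V"
  obtains a v where "v \<in> V" "y = v + (\<Sum>i<n. a i *\<^sub>R x i)"
  using assms(1)
proof (induction n arbitrary: y thesis)
  case 0
  have "span V = V" using V by simp
  then have "y \<in> V" using 0(2) by (metis Un_empty_right image_empty lessThan_0)
  then show ?case using 0(1)[of y "\<lambda>_. 0"] by simp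
next
  case (Suc n)
  have "V \<union> x ` {..<Suc n} = insert (x n) (V \<union> x ` {..<n})" by (auto simp: lessThan_Suc)
  then obtain k where "y - k *\<^sub>R x n \<in> span (V \<union> x ` {..<n})"
    using Suc.prems(2) by (auto simp: span_insert)
  then obtain a v where av: "v \<in> V" "y - k *\<^sub>R x n = v + (\<Sum>i<n. a i *\<^sub>R x i)" using Suc.IH by blast
  have "(\<Sum>i<Suc n. (a(n := k)) i *\<^sub>R x i) = (\<Sum>i<n. a i *\<^sub>R x i) + k *\<^sub>R x n" by simp
  then have "y = v + (\<Sum>i<Suc n. (a(n := k)) i *\<^sub>R x i)" using av(2) by (simp add: algebra_simps)
  then show ?case using Suc.prems(1) av(1) by blast
qed

text \<open>By Riesz's lemma the vectors can be chosen inductively at distance at least \<open>1/2\<close> from the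
  span of \<open>V\<close> and their predecessors; the point is that the lower bound depends on \<open>k\<close> only.\<close>

lemma uniformly_free_vectors_exist:
  fixes V :: "'a::real_normed_vector set"
  assumes V: "subspace V" "closed V" and U: "subspace U" "V \<subseteq> U" and k: "enat k \<le> rdim V U"
  shows "\<exists>x. (\<forall>i<k. x i \<in> U \<and> norm (x i) \<le> 1) \<and>
           (\<forall>a. \<forall>v\<in>V. (\<Sum>i<k. \<bar>a i\<bar>) * (1/5) ^ k \<le> norm ((\<Sum>i<k. a i *\<^sub>R x i) - v))"
  using k
proof (induction k)
  case (Suc k)
  then have "enat k \<le> rdim V U" using order_trans[of "enat k" "enat (Suc k)"] by simp
  then obtain x where x: "\<And>i. i < k \<Longrightarrow> x i \<in> U \<and> norm (x i) \<le> 1"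
    and xa: "\<And>a v. v \<in> V \<Longrightarrow> (\<Sum>i<k. \<bar>a i\<bar>) * (1/5) ^ k \<le> norm ((\<Sum>i<k. a i *\<^sub>R x i) - v)"
    using Suc.IH by blast
  define L where "L = span (V \<union> x ` {..<k})"
  have L: "subspace L" "closed L" using V by (auto simp: L_def closed_span_Un_finite)
  have LU: "L \<subseteq> U" unfolding L_def using x U by (intro span_minimal) auto
  have "\<not> U \<subseteq> L"
  proof
    assume "U \<subseteq> L"
    then have "rdim V U \<le> card (x ` {..<k})" using x by (intro rdim_le_card) (auto simp: L_def)
    also have "card (x ` {..<k}) \<le> k" using card_image_le[of "{..<k}" x] by simp
    finally show False using Suc.prems order_trans[of "enat (Suc k)" "rdim V U" "enat k"] by simp
  qed
  then obtain u where u: "u \<in> U" "u \<notin> L" by auto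
  define d where "d = infdist u L"
  have d: "d > 0" unfolding d_def using distance_to_closed_subspace(1)[OF L u(2)] .
  \<comment> \<open>The distance need not be attained; a point within twice the distance suffices
    and leads to the bound \<open>\<bar>t\<bar> / 2\<close> below.\<close>
  have "\<exists>w\<in>L. dist u w < 2 * d"
  proof (rule ccontr)
    assume "\<not> ?thesis"
    moreover have "L \<noteq> {}" using L(1) subspace_0 by blast
    ultimately have "2 * d \<le> infdist u L" unfolding infdist_def by (auto intro!: cINF_greatest simp: not_less)
    then show False using d by (simp add: d_def)
  qed
  then obtain w where w: "w \<in> L" "dist u w < 2 * d" by auto
  define n where "n = norm (u - w)"
  have n: "n > 0" "n < 2 * d" using w u by (auto simp: n_def dist_norm)
  define z where "z = (u - w) /\<^sub>R n"
  have z: "z \<in> U" "norm z = 1" using n u w LU U(1) by (auto simp: z_def n_def subspace_scale subspace_diff)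
  have zl: "\<bar>t\<bar> / 2 \<le> norm (t *\<^sub>R z - l)" if l: "l \<in> L" for t l
  proof -
    have "(t / n) *\<^sub>R w + l \<in> L" using l w L by (auto intro: subspace_add subspace_scale)
    then have "\<bar>t / n\<bar> * d \<le> norm ((t / n) *\<^sub>R u - ((t / n) *\<^sub>R w + l))"
      unfolding d_def by (rule distance_to_closed_subspace(2)[OF L u(2)])
    also have "(t / n) *\<^sub>R u - ((t / n) *\<^sub>R w + l) = t *\<^sub>R z - l"
      by (simp add: z_def algebra_simps divide_inverse)
    finally have "\<bar>t\<bar> * d / n \<le> norm (t *\<^sub>R z - l)" using n by (simp add: abs_divide)
    moreover have "\<bar>t\<bar> / 2 \<le> \<bar>t\<bar> * d / n" using n mult_left_mono[of n "2*d" "\<bar>t\<bar>"] by (simp add: field_simps)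
    ultimately show ?thesis by linarith
  qed
  let ?x = "x(k := z)"
  have "(\<Sum>i<Suc k. \<bar>a i\<bar>) * (1/5) ^ Suc k \<le> norm ((\<Sum>i<Suc k. a i *\<^sub>R ?x i) - v)" if v: "v \<in> V" for a v
  proof -
    define r where "r = norm ((\<Sum>i<Suc k. a i *\<^sub>R ?x i) - v)"
    define s where "s = (\<Sum>i<k. a i *\<^sub>R x i)"
    have rs: "(\<Sum>i<Suc k. a i *\<^sub>R ?x i) = s + a k *\<^sub>R z" by (simp add: s_def)
    have "s \<in> L" unfolding s_def L_def by (intro span_sum span_scale span_base) auto
    moreover have "v \<in> L" using v by (auto simp: L_def span_base)
    ultimately have "\<bar>a k\<bar> / 2 \<le> norm (a k *\<^sub>R z - (v - s))" using L by (intro zl) (auto intro: subspace_diff)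
    then have ak: "\<bar>a k\<bar> \<le> 2 * r" unfolding r_def rs by (simp add: algebra_simps)
    have "(\<Sum>i<k. \<bar>a i\<bar>) * (1/5) ^ k \<le> norm (s - v)" unfolding s_def using v by (rule xa)
    also have "s - v = (s + a k *\<^sub>R z - v) - a k *\<^sub>R z" by simp
    also have "norm \<dots> \<le> r + \<bar>a k\<bar>"
      using norm_triangle_ineq4[of "s + a k *\<^sub>R z - v" "a k *\<^sub>R z"] z unfolding r_def rs by simp
    \<comment> \<open>The last coefficient is at most \<open>2 * r\<close>, the others contribute at
      most \<open>r + 2 * r\<close>. The total \<open>5 * r\<close> is the origin of the factor 1/5
      per vector.\<close>
    finally have 1: "(\<Sum>i<k. \<bar>a i\<bar>) * (1/5) ^ k \<le> 3 * r" using ak by linarith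
    have "\<bar>a k\<bar> * (1/5::real) ^ k \<le> \<bar>a k\<bar> * 1" by (intro mult_left_mono power_le_one) auto
    then have "((\<Sum>i<k. \<bar>a i\<bar>) + \<bar>a k\<bar>) * (1/5) ^ k \<le> 5 * r" using 1 ak by (simp add: distrib_right)
    then show ?thesis unfolding r_def[symmetric] by (simp add: field_simps)
  qed
  moreover have "\<forall>i<Suc k. ?x i \<in> U \<and> norm (?x i) \<le> 1" using x z by (auto simp: less_Suc_eq)
  ultimately show ?case by blast
qed auto

text \<open>Approximation runs from \<open>U\<close> to \<open>U'\<close> but from \<open>V'\<close>
  back to \<open>V\<close>. Let \<open>s\<close> be the sum of the absolute coefficients. Replacing
  the \<open>x i\<close> by nearby \<open>y i\<close> costs \<open>\<delta> * s\<close>; a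
  combination of the \<open>y i\<close> lying in \<open>V'\<close> has norm at most
  \<open>2 * s\<close>, and moving it into \<open>V\<close> costs \<open>2 * \<delta> * s\<close>.
  The total \<open>3 * \<delta> * s\<close> is below the lower bound for the \<open>x i\<close>
  unless every coefficient vanishes.\<close>

lemma le_rdim_of_small_gap:
  fixes V :: "'a::real_normed_vector set"
  assumes V: "subspace V" "closed V" and U: "subspace U" "V \<subseteq> U"
    and V': "subspace V'" and U': "subspace U'" "V' \<subseteq> U'"
    and gU: "\<And>u. u \<in> U \<Longrightarrow> \<exists>u'\<in>U'. norm (u - u') \<le> \<delta> * norm u"
    and gV: "\<And>v. v \<in> V' \<Longrightarrow> \<exists>v'\<in>V. norm (v - v') \<le> \<delta> * norm v"
    and \<delta>: "0 \<le> \<delta>" "3 * \<delta> < (1/5) ^ k"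
    and k: "enat k \<le> rdim V U"
  shows "enat k \<le> rdim V' U'"
proof -
  obtain x where x: "\<And>i. i < k \<Longrightarrow> x i \<in> U \<and> norm (x i) \<le> 1"
    and xa: "\<And>a v. v \<in> V \<Longrightarrow> (\<Sum>i<k. \<bar>a i\<bar>) * (1/5) ^ k \<le> norm ((\<Sum>i<k. a i *\<^sub>R x i) - v)"
    using uniformly_free_vectors_exist[OF V U k] by blast
  have "\<exists>u'\<in>U'. norm (x i - u') \<le> \<delta>" if i: "i < k" for i
  proof -
    obtain u' where "u' \<in> U'" "norm (x i - u') \<le> \<delta> * norm (x i)" using gU[of "x i"] x[of i] i by blast
    moreover have "\<delta> * norm (x i) \<le> \<delta>" using x that \<delta> by (simp add: mult_left_le)
    ultimately show ?thesis by force
  qed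
  then obtain y where y: "\<And>i. i < k \<Longrightarrow> y i \<in> U' \<and> norm (x i - y i) \<le> \<delta>" by metis
  have "(1/5::real) ^ k \<le> 1" by (intro power_le_one) auto
  then have \<delta>1: "\<delta> \<le> 1" using \<delta> by simp
  have yn: "norm (y i) \<le> 2" if "i < k" for i
    using norm_triangle_ineq4[of "x i" "x i - y i"] x[OF that] y[OF that] \<delta>1 by simp
  have free: "\<forall>i<k. a i = 0" if a: "(\<Sum>i<k. a i *\<^sub>R y i) \<in> V'" for a
  proof -
    define s where "s = (\<Sum>i<k. \<bar>a i\<bar>)"
    have s0: "s \<ge> 0" by (simp add: s_def sum_nonneg)
    let ?v = "\<Sum>i<k. a i *\<^sub>R y i"
    obtain v where v: "v \<in> V" "norm (?v - v) \<le> \<delta> * norm ?v" using gV a by blast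
    have "norm ?v \<le> (\<Sum>i<k. \<bar>a i\<bar> * 2)"
      using yn by (intro sum_norm_le) (simp add: mult_left_mono)
    then have "norm ?v \<le> 2 * s" by (simp add: s_def sum_distrib_left mult.commute)
    then have 1: "norm (?v - v) \<le> \<delta> * (2 * s)" using v(2) \<delta>(1) mult_left_mono order_trans by blast
    have "norm (\<Sum>i<k. a i *\<^sub>R (x i - y i)) \<le> (\<Sum>i<k. \<bar>a i\<bar> * \<delta>)"
      using y by (intro sum_norm_le) (simp add: mult_left_mono)
    then have 2: "norm (\<Sum>i<k. a i *\<^sub>R (x i - y i)) \<le> \<delta> * s" by (simp add: s_def sum_distrib_left mult.commute)
    have eq: "(\<Sum>i<k. a i *\<^sub>R x i) - v = (\<Sum>i<k. a i *\<^sub>R (x i - y i)) + (?v - v)"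
      by (simp add: scaleR_diff_right sum_subtractf)
    have "norm ((\<Sum>i<k. a i *\<^sub>R x i) - v) \<le> \<delta> * s + \<delta> * (2 * s)"
      unfolding eq using 1 2 norm_triangle_ineq[of "\<Sum>i<k. a i *\<^sub>R (x i - y i)" "?v - v"] by linarith
    then have "s * (1/5) ^ k \<le> s * (3 * \<delta>)" using xa[OF v(1), of a] by (simp add: s_def algebra_simps)
    then have "s = 0" using \<delta>(2) s0 by (metis mult_le_cancel_left_pos not_le order_le_less)
    then show ?thesis by (simp add: s_def sum_nonneg_eq_0_iff)
  qed
  show ?thesis
  proof (rule le_rdim_if_free[OF V' U', of k y])
    fix i assume i: "i < k"
    have "y i \<notin> span (V' \<union> y ` {..<i})"
    proof
      assume "y i \<in> span (V' \<union> y ` {..<i})"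
      then obtain a v where av: "v \<in> V'" "y i = v + (\<Sum>j<i. a j *\<^sub>R y j)"
        using span_image_lessThan V' by metis
      \<comment> \<open>\<open>b\<close> turns the assumed dependence into a combination lying in
        \<open>V'\<close> whose coefficient at \<open>i\<close> is 1.\<close>
      define b where "b j = (if j < i then - a j else if j = i then 1 else 0)" for j
      have "(\<Sum>j<k. b j *\<^sub>R y j) = (\<Sum>j<Suc i. b j *\<^sub>R y j)"
        using i by (intro sum.mono_neutral_right) (auto simp: b_def)
      also have "\<dots> = (\<Sum>j<i. - a j *\<^sub>R y j) + y i" by (simp add: b_def)
      also have "\<dots> = v" using av(2) by (simp add: sum_negf)
      finally have "b i = 0" using free[of b] av(1) i by simp
      then show False by (simp add: b_def)
    qed
    then show "y i \<in> U' \<and> y i \<notin> span (V' \<union> y ` {..<i})" using y i by blast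
  qed
qed

text \<open>Two points of a ball of radius \<open>\<eta> / 2\<close> are less than \<eta> apart, so
  the step applies to them in either order. Connectedness of the disc then bridges the distance,
  however small \<eta> is compared with \<epsilon>.\<close>

lemma ball_propagate:
  fixes P :: "complex \<Rightarrow> bool"
  assumes "\<eta> > 0" and step: "\<And>a b. cmod a < \<epsilon> \<Longrightarrow> cmod b < \<epsilon> \<Longrightarrow> cmod (a - b) < \<eta> \<Longrightarrow> P a \<Longrightarrow> P b"
    and "cmod a < \<epsilon>" "cmod b < \<epsilon>" "P a"
  shows "P b"
proof (rule connected_induction_simple[where S = "ball 0 \<epsilon>" and P = P and a = a and b = b])
  fix c assume c: "c \<in> ball (0::complex) \<epsilon>"
  show "\<exists>T. openin (top_of_set (ball 0 \<epsilon>)) T \<and> c \<in> T \<and> (\<forall>x\<in>T. \<forall>y\<in>T. P x \<longrightarrow> P y)"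
  proof (intro exI conjI ballI impI)
    show "openin (top_of_set (ball 0 \<epsilon>)) (ball 0 \<epsilon> \<inter> ball c (\<eta>/2))" by (simp add: openin_open_Int)
    show "c \<in> ball 0 \<epsilon> \<inter> ball c (\<eta>/2)" using c assms(1) by simp
    fix x y assume xy: "x \<in> ball 0 \<epsilon> \<inter> ball c (\<eta>/2)" "y \<in> ball 0 \<epsilon> \<inter> ball c (\<eta>/2)" and "P x"
    from xy have "dist c x < \<eta>/2" "dist c y < \<eta>/2" by simp_all
    then have "dist x y < \<eta>" by (rule dist_triangle_half_r)
    then have "cmod (x - y) < \<eta>" by (simp add: dist_norm)
    moreover from xy have "cmod x < \<epsilon>" "cmod y < \<epsilon>" by simp_all
    ultimately show "P y" using \<open>P x\<close> by (intro step[of x y])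
  qed
qed (use assms(3-5) in simp_all)

section \<open>Perturbation of Kato operators\<close>

locale complex_banach =
  fixes scl :: "complex \<Rightarrow> 'a::banach \<Rightarrow> 'a"
  assumes complex_structure: "complex_structure scl"
begin

abbreviation sh :: "('a \<Rightarrow> 'a) \<Rightarrow> complex \<Rightarrow> 'a \<Rightarrow> 'a" where "sh \<equiv> shift scl"

lemma scl_of_real: "scl (complex_of_real r) x = r *\<^sub>R x"
  and scl_mult: "scl (a * b) x = scl a (scl b x)"
  and scl_add_right: "scl a (x + y) = scl a x + scl a y"
  and scl_add_left: "scl (a + b) x = scl a x + scl b x"
  and norm_scl: "norm (scl a x) = cmod a * norm x"
  using complex_structure unfolding complex_structure_def by blast+

lemma bounded_linear_scl: "bounded_linear (scl a)"
proof (rule bounded_linear_intro[of _ "cmod a"])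
  show "scl a (r *\<^sub>R x) = r *\<^sub>R scl a x" for r x
    by (metis scl_of_real scl_mult mult.commute)
qed (simp_all add: scl_add_right norm_scl mult.commute)

lemma scl_0 [simp]: "scl 0 x = 0"
  using norm_scl[of 0 x] by simp

lemma scl_1 [simp]: "scl 1 x = x"
  using scl_of_real[of 1 x] by simp

lemma scl_diff_left: "scl (a - b) x = scl a x - scl b x"
  using scl_add_left[of "a - b" b x] by simp

lemma scl_diff_right: "scl a (x - y) = scl a x - scl a y"
  by (rule linear_diff[OF bounded_linear.linear[OF bounded_linear_scl]])

lemma scl_inverse: "a \<noteq> 0 \<Longrightarrow> scl (inverse a) (scl a x) = x"
  by (metis scl_mult left_inverse scl_1)

lemma is_op_linear: "is_op scl T \<Longrightarrow> linear T"
  and is_op_bounded_linear: "is_op scl T \<Longrightarrow> bounded_linear T"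
  and is_op_scl: "is_op scl T \<Longrightarrow> T (scl a x) = scl a (T x)"
  by (simp_all add: is_op_def bounded_linear.linear)

lemma shift_apply: "sh T a x = T x - scl a x"
  by (simp add: shift_def)

lemma shift_0 [simp]: "sh T 0 = T"
  by (simp add: shift_def)

lemma shift_shift: "sh (sh T a) b = sh T (a + b)"
  by (simp add: shift_def scl_add_left fun_eq_iff)

lemma is_op_shift: "is_op scl T \<Longrightarrow> is_op scl (sh T a)"
  unfolding is_op_def shift_def
  by (auto intro: bounded_linear_sub bounded_linear_scl simp: scl_diff_right simp flip: scl_mult)
     (simp add: mult.commute)

lemma is_op_funpow: "is_op scl T \<Longrightarrow> is_op scl (T ^^ n)"
proof (induction n)
  case 0
  then show ?case by (auto simp: is_op_def id_def bounded_linear_ident)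
next
  case (Suc n)
  then show ?case by (auto simp: is_op_def o_def intro: bounded_linear_compose)
qed

lemma csubspace_image: "is_op scl f \<Longrightarrow> csubspace scl V \<Longrightarrow> csubspace scl (f ` V)"
  unfolding csubspace_def using is_op_linear
  by (auto intro!: linear_subspace_image) (metis is_op_scl imageI)

lemma csubspace_ker:
  assumes "is_op scl f" "csubspace scl V" shows "csubspace scl {x\<in>V. f x = 0}"
proof -
  interpret f: linear f using assms is_op_linear by blast
  show ?thesis
    using assms unfolding csubspace_def
    by (auto simp: subspace_def f.zero f.add f.scale is_op_scl)
       (metis bounded_linear_scl linear_0 bounded_linear.linear)
qed

lemma csubspace_subspace: "csubspace scl V \<Longrightarrow> subspace V"
  by (simp add: csubspace_def)

lemma csubspace_INT: "(\<And>i. csubspace scl (A i)) \<Longrightarrow> csubspace scl (\<Inter>i. A i)"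
  unfolding csubspace_def by (auto intro!: subspace_Inter)

lemma shift_in:
  "csubspace scl V \<Longrightarrow> T ` V \<subseteq> V \<Longrightarrow> x \<in> V \<Longrightarrow> sh T a x \<in> V"
  unfolding csubspace_def shift_def by (auto intro!: subspace_diff)

lemma shift_image: "csubspace scl V \<Longrightarrow> T ` V \<subseteq> V \<Longrightarrow> sh T a ` V \<subseteq> V"
  using shift_in by blast

lemma funpow_image_subset: "T ` V \<subseteq> V \<Longrightarrow> (T ^^ n) ` V \<subseteq> (V::'a set)"
  by (induction n) auto

lemma funpow_image_antimono:
  assumes "T ` V \<subseteq> V" "m \<le> n" shows "(T ^^ n) ` V \<subseteq> (T ^^ m) ` (V::'a set)"
proof -
  have "(T ^^ n) ` V = (T ^^ m) ` (T ^^ (n - m)) ` V"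
    using assms(2) by (metis image_comp funpow_add le_add_diff_inverse)
  then show ?thesis using funpow_image_subset[OF assms(1), of "n - m"] by auto
qed

lemma funpow_Suc_image: "(T ^^ Suc n) ` V = T ` (T ^^ n) ` V" "(T ^^ Suc n) ` V = (T ^^ n) ` T ` V"
  by (auto simp: image_comp funpow_swap1 simp del: funpow.simps simp add: funpow.simps(2))

text \<open>If \<open>T x = y\<close>, then \<open>sh T a x\<close> misses \<open>y\<close> by
  exactly \<open>scl a x\<close>, whose norm is at most half that of \<open>y\<close>.\<close>

lemma shift_onto_near:
  assumes T: "is_op scl T" and K: "csubspace scl K" "closed K" "T ` K \<subseteq> K" and "c > 0"
    and c: "\<And>y. y \<in> K \<Longrightarrow> \<exists>x\<in>K. T x = y \<and> norm x \<le> c * norm y"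
    and a: "cmod a * c \<le> 1/2" and y: "y \<in> K"
  shows "\<exists>x\<in>K. sh T a x = y \<and> norm x \<le> 2 * c * norm y"
proof (rule approximately_onto_imp_onto[OF is_op_bounded_linear[OF is_op_shift[OF T]] _ K(2) _ _ _ _ y])
  show "\<exists>x\<in>K. norm x \<le> c * norm y \<and> norm (y - sh T a x) \<le> norm y / 2" if "y \<in> K" for y
  proof -
    obtain x where x: "x \<in> K" "T x = y" "norm x \<le> c * norm y" using c \<open>y \<in> K\<close> by blast
    have "norm (y - sh T a x) = cmod a * norm x" by (simp add: shift_apply x norm_scl)
    also have "\<dots> \<le> cmod a * (c * norm y)" using x by (intro mult_left_mono) auto
    also have "\<dots> \<le> norm y / 2" using mult_right_mono[OF a, of "norm y"] by simp
    finally show ?thesis using x by blast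
  qed
qed (use K \<open>c > 0\<close> in \<open>auto simp: csubspace_def intro: shift_in\<close>)

text \<open>By the Kato condition each iterated range contains the kernel of \<open>T\<close> on
  \<open>M\<close>, so its closedness passes to its image.\<close>

lemma kato_range_closed:
  assumes T: "is_op scl T" and M: "csubspace scl M" "closed M" "T ` M \<subseteq> M" and "kato_on M T"
  shows "closed ((T ^^ n) ` M)"
proof (induction n)
  case (Suc n)
  have "closed (T ` (T ^^ n) ` M)"
  proof (rule closed_image_containing_kernel[OF is_op_bounded_linear[OF T], of M])
    show "subspace ((T ^^ n) ` M)" "subspace M" "closed (T ` M)"
      using csubspace_image[OF is_op_funpow[OF T] M(1)] M(1) assms(5) by (auto simp: csubspace_def kato_on_def)
    show "(T ^^ n) ` M \<subseteq> M" using funpow_image_subset M by blast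
    show "x \<in> (T ^^ n) ` M" if "x \<in> M" "T x = 0" for x using assms(5) that unfolding kato_on_def by blast
  qed (use M Suc in auto)
  then show ?case by (simp only: funpow_Suc_image)
qed (use M in simp)

lemma kato_core:
  assumes T: "is_op scl T" and M: "csubspace scl M" "closed M" "T ` M \<subseteq> M" and kato: "kato_on M T"
  obtains K where "csubspace scl K" "closed K" "K \<subseteq> M" "T ` K = K" "\<And>x. x \<in> M \<Longrightarrow> T x = 0 \<Longrightarrow> x \<in> K"
proof -
  define K where "K = (\<Inter>n. (T ^^ n) ` M)"
  have "csubspace scl ((T ^^ n) ` M)" for n by (rule csubspace_image[OF is_op_funpow[OF T] M(1)])
  then have "csubspace scl K" unfolding K_def by (rule csubspace_INT)
  moreover have "closed K" unfolding K_def using kato_range_closed[OF assms] by blast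
  moreover have KM: "K \<subseteq> M" unfolding K_def using INF_lower[of 0 UNIV "\<lambda>n. (T ^^ n) ` M"] by simp
  moreover have ker: "x \<in> K" if "x \<in> M" "T x = 0" for x
    using kato that unfolding K_def kato_on_def by blast
  moreover have "T ` K = K"
  proof
    show "T ` K \<subseteq> K"
    proof
      fix y assume "y \<in> T ` K"
      then have "y \<in> T ` (T ^^ n) ` M" for n unfolding K_def by blast
      then have "y \<in> (T ^^ Suc n) ` M" for n by (simp only: funpow_Suc_image)
      then have "y \<in> (T ^^ n) ` M" for n using funpow_image_antimono[OF M(3), of n "Suc n"] by auto
      then show "y \<in> K" by (simp add: K_def)
    qed
    show "K \<subseteq> T ` K"
    proof
      fix y assume y: "y \<in> K"
      have yn: "y \<in> T ` (T ^^ n) ` M" for n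
        using y unfolding K_def funpow_Suc_image(1)[symmetric] by blast
      then obtain x where x: "x \<in> M" "y = T x" using yn[of 0] by auto
      \<comment> \<open>The fixed preimage \<open>x\<close> is compared with a preimage
        \<open>z\<close> taken from the \<open>n\<close>-th range: they differ by a kernel vector,
        which the Kato condition places in the same range. Hence one \<open>x\<close> serves all
        \<open>n\<close>.\<close>
      have "x \<in> (T ^^ n) ` M" for n
      proof -
        obtain z where z: "z \<in> (T ^^ n) ` M" "y = T z" using yn[of n] by blast
        have zM: "z \<in> M" using z funpow_image_subset[OF M(3)] by blast
        have "T (x - z) = 0" using x z linear_diff[OF is_op_linear[OF T]] by simp
        moreover have "x - z \<in> M" using x zM M by (auto simp: csubspace_def subspace_diff)
        ultimately have "x - z \<in> (T ^^ n) ` M" using kato unfolding kato_on_def by blast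
        then have "x - z + z \<in> (T ^^ n) ` M"
          using z csubspace_image[OF is_op_funpow[OF T] M(1)] by (intro subspace_add) (auto simp: csubspace_def)
        then show ?thesis by simp
      qed
      then show "y \<in> T ` K" using x by (auto simp: K_def)
    qed
  qed
  ultimately show ?thesis using that by blast
qed

text \<open>The reduced minimum modulus of \<open>T - a\<close> stays bounded below near a Kato operator.
  The gap estimates in \<open>kato_stable\<close> use nothing else about \<open>T - a\<close>.\<close>

lemma kato_uniform:
  assumes T: "is_op scl T" and M: "csubspace scl M" "closed M" "T ` M \<subseteq> M" and kato: "kato_on M T"
  obtains \<epsilon> C K where "\<epsilon> > 0" "C > 0" "K \<subseteq> M"
    "\<And>a x. cmod a < \<epsilon> \<Longrightarrow> x \<in> M \<Longrightarrow> \<exists>x'\<in>M. sh T a x' = sh T a x \<and> norm x' \<le> C * norm (sh T a x)"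
    "\<And>a. cmod a < \<epsilon> \<Longrightarrow> sh T a ` K = K"
    "\<And>a x. cmod a < \<epsilon> \<Longrightarrow> x \<in> M \<Longrightarrow> sh T a x = 0 \<Longrightarrow> x \<in> K"
proof -
  obtain K where K: "csubspace scl K" "closed K" "K \<subseteq> M" "T ` K = K" and ker: "\<And>x. x \<in> M \<Longrightarrow> T x = 0 \<Longrightarrow> x \<in> K"
    using kato_core[OF assms] by blast
  have bT: "bounded_linear T" using T is_op_bounded_linear by blast
  have sM: "subspace M" and sK: "subspace K" using M K by (auto simp: csubspace_def)
  have "closed (T ` M)" "closed (T ` K)" using kato K by (auto simp: kato_on_def)
  then obtain c1 c2 where c1: "c1 > 0" "\<And>y. y \<in> T ` M \<Longrightarrow> \<exists>x\<in>M. T x = y \<and> norm x \<le> c1 * norm y"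
    and c2: "c2 > 0" "\<And>y. y \<in> T ` K \<Longrightarrow> \<exists>x\<in>K. T x = y \<and> norm x \<le> c2 * norm y"
    using open_mapping_closed_subspace[OF bT sM M(2)] open_mapping_closed_subspace[OF bT sK K(2)] by metis
  define c where "c = max c1 c2"
  have c: "c > 0" "c1 \<le> c" "c2 \<le> c" using c1 by (auto simp: c_def)
  have cM: "\<exists>x\<in>M. T x = y \<and> norm x \<le> c * norm y" if "y \<in> T ` M" for y
    using c1(2)[OF that] mult_right_mono[OF c(2), of "norm y"] by force
  have cK: "\<exists>x\<in>K. T x = y \<and> norm x \<le> c * norm y" if "y \<in> K" for y
    using c2(2)[of y] that mult_right_mono[OF c(3), of "norm y"] K(4) by force
  obtain B where B: "B > 0" "\<And>x. norm (T x) \<le> norm x * B" using bounded_linear.pos_bounded[OF bT] by blast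
  \<comment> \<open>The bound 1 keeps the norm of \<open>T - a\<close> at most \<open>B + 1\<close>;
    the bound \<open>1 / (4 * c)\<close> makes the scalar term absorbable, both in
    \<open>near\<close> and in \<open>onK\<close>.\<close>
  define \<epsilon> where "\<epsilon> = min 1 (1 / (4 * c))"
  have \<epsilon>: "\<epsilon> > 0" using c by (simp add: \<epsilon>_def)
  have small: "cmod a \<le> 1" "cmod a * c \<le> 1/4" if "cmod a < \<epsilon>" for a
    using that c by (auto simp: \<epsilon>_def field_simps)
  \<comment> \<open>\<open>T\<close> is bounded below modulo \<open>K\<close>, because
    \<open>K\<close> contains the kernel and \<open>T\<close> maps \<open>K\<close> onto itself. The
    distance \<open>d\<close> from \<open>x\<close> to \<open>K\<close> therefore satisfies
    \<open>d \<le> c * (norm (sh T a x) + cmod a * (2 * d))\<close>, and the term with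
    \<open>d\<close> is absorbed.\<close>
  have near: "\<exists>k\<in>K. norm (x - k) \<le> 4 * c * norm (sh T a x)" if a: "cmod a < \<epsilon>" and x: "x \<in> M" for a x
  proof (cases "x \<in> K")
    case True
    then show ?thesis using c by (intro bexI[of _ x]) auto
  next
    case False
    define d where "d = infdist x K"
    have d: "d > 0" unfolding d_def using distance_to_closed_subspace(1)[OF sK K(2) False] .
    have "\<exists>w\<in>K. dist x w < 2 * d"
    proof (rule ccontr)
      assume "\<not> ?thesis"
      moreover have "K \<noteq> {}" using sK subspace_0 by blast
      ultimately have "2 * d \<le> infdist x K" unfolding infdist_def by (auto intro!: cINF_greatest simp: not_less)
      then show False using d by (simp add: d_def)
    qed
    then obtain k0 where k0: "k0 \<in> K" "norm (x - k0) \<le> 2 * d" by (force simp: dist_norm)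
    have "scl a k0 \<in> K" using K(1) k0 by (simp add: csubspace_def)
    \<comment> \<open>Subtracting \<open>k1\<close> turns \<open>T x\<close> into
      \<open>sh T a x + scl a (x - k0)\<close>, which is controlled by \<open>sh T a x\<close> and
      the distance to \<open>K\<close> alone.\<close>
    then obtain k1 where k1: "k1 \<in> K" "T k1 = scl a k0" using K(4) by (metis imageE)
    have eq: "T (x - k1) = sh T a x + scl a (x - k0)"
      using linear_diff[OF is_op_linear[OF T]] k1 by (simp add: shift_apply scl_diff_right)
    have "x - k1 \<in> M" using x k1 K(3) sM by (auto simp: subspace_diff)
    then obtain z where z: "z \<in> M" "T z = T (x - k1)" "norm z \<le> c * norm (T (x - k1))" using cM by blast
    have "x - k1 - z \<in> K"
      using \<open>x - k1 \<in> M\<close> z sM linear_diff[OF is_op_linear[OF T], of "x - k1" z]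
      by (intro ker) (auto simp: subspace_diff)
    from subspace_add[OF sK this k1(1)] have "x - z \<in> K" by (simp add: algebra_simps)
    then have "d \<le> norm z" unfolding d_def using infdist_le[of "x - z" K x] by (simp add: dist_norm)
    also have "\<dots> \<le> c * (norm (sh T a x) + cmod a * (2 * d))"
    proof (rule order_trans[OF z(3)], intro mult_left_mono)
      have "norm (T (x - k1)) \<le> norm (sh T a x) + cmod a * norm (x - k0)"
        unfolding eq using norm_triangle_ineq[of "sh T a x" "scl a (x - k0)"] by (simp add: norm_scl)
      then show "norm (T (x - k1)) \<le> norm (sh T a x) + cmod a * (2 * d)"
        using mult_left_mono[OF k0(2), of "cmod a"] by simp
    qed (use c in simp)
    also have "\<dots> \<le> c * norm (sh T a x) + d / 2"
      using mult_right_mono[OF small(2)[OF a], of "2 * d"] d by (simp add: algebra_simps)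
    finally have "2 * d \<le> 4 * c * norm (sh T a x)" by simp
    then show ?thesis using k0 by (intro bexI[of _ k0]) auto
  qed
  have onK: "\<exists>x\<in>K. sh T a x = y \<and> norm x \<le> 2 * c * norm y" if "cmod a < \<epsilon>" "y \<in> K" for a y
    using shift_onto_near[OF T K(1,2) _ c(1) cK _ that(2)] small(2)[OF that(1)] K(4) by simp
  \<comment> \<open>In \<open>x = (x - k) + k\<close> the first part costs \<open>4 * c\<close>. The
    second is exchanged for a preimage in \<open>K\<close> of \<open>sh T a k\<close>, at the price
    of \<open>2 * c\<close> times \<open>norm (sh T a x) + norm (sh T a (x - k))\<close>, where
    \<open>B + 1\<close> bounds \<open>T - a\<close>.\<close>
  define C where "C = 4 * c + 2 * c * (1 + (B + 1) * (4 * c))"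
  have C: "C > 0" using c B by (auto simp: C_def intro!: add_pos_nonneg mult_nonneg_nonneg)
  show ?thesis
  proof (rule that[OF \<epsilon> C K(3)])
    fix a :: complex assume a: "cmod a < \<epsilon>"
    show "sh T a ` K = K"
    proof
      show "sh T a ` K \<subseteq> K" using K by (intro shift_image) auto
      show "K \<subseteq> sh T a ` K" using onK[OF a] by force
    qed
    fix x assume x: "x \<in> M"
    obtain k where k: "k \<in> K" "norm (x - k) \<le> 4 * c * norm (sh T a x)" using near[OF a x] by blast
    show "x \<in> K" if "sh T a x = 0" using k that by simp
    let ?y = "norm (sh T a x)"
    have lin: "linear (sh T a)" using is_op_shift[OF T] by (rule is_op_linear)
    have "sh T a k \<in> K" using K k by (intro shift_in) auto
    then obtain k' where k': "k' \<in> K" "sh T a k' = sh T a k" "norm k' \<le> 2 * c * norm (sh T a k)"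
      using onK[OF a] by blast
    have "norm (sh T a (x - k)) \<le> norm (T (x - k)) + norm (scl a (x - k))"
      unfolding shift_apply by (rule norm_triangle_ineq4)
    also have "\<dots> \<le> (B + 1) * norm (x - k)"
      using B(2)[of "x - k"] mult_right_mono[OF small(1)[OF a], of "norm (x - k)"]
      by (simp add: norm_scl algebra_simps)
    also have "\<dots> \<le> (B + 1) * (4 * c * ?y)" using k B by (intro mult_left_mono) auto
    finally have 1: "norm (sh T a (x - k)) \<le> (B + 1) * (4 * c * ?y)" .
    have "sh T a k = sh T a x - sh T a (x - k)" by (simp add: linear_diff[OF lin])
    then have "norm (sh T a k) \<le> ?y + (B + 1) * (4 * c * ?y)"
      using 1 norm_triangle_ineq4[of "sh T a x" "sh T a (x - k)"] by simp
    then have "2 * c * norm (sh T a k) \<le> 2 * c * (?y + (B + 1) * (4 * c * ?y))"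
      using c by (intro mult_left_mono) auto
    then have "norm k' \<le> 2 * c * (?y + (B + 1) * (4 * c * ?y))" using k'(3) by linarith
    then have "norm (x - k + k') \<le> 4 * c * ?y + 2 * c * (?y + (B + 1) * (4 * c * ?y))"
      using k(2) norm_triangle_ineq[of "x - k" k'] by linarith
    also have "\<dots> = C * ?y" by (simp add: C_def algebra_simps)
    finally have "norm (x - k + k') \<le> C * ?y" .
    moreover have "x - k + k' \<in> M" using x k k' K(3) sM by (auto intro!: subspace_add subspace_diff)
    moreover have "sh T a (x - k + k') = sh T a x" by (simp add: linear_diff[OF lin] linear_add[OF lin] k')
    ultimately show "\<exists>x'\<in>M. sh T a x' = sh T a x \<and> norm x' \<le> C * ?y" by blast
  qed
qed

abbreviation kern_on :: "'a set \<Rightarrow> ('a \<Rightarrow> 'a) \<Rightarrow> 'a set" where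
  "kern_on M f \<equiv> {x\<in>M. f x = 0}"

text \<open>A point of the closure is approximated to within half its norm by some
  \<open>f x\<close>, and \<open>C\<close> yields a preimage of controlled size. Successive
  approximation with the closure as target then solves \<open>f x = y\<close> exactly.\<close>

lemma closed_range_if_bounded_modulus:
  fixes f :: "'a \<Rightarrow> 'a"
  assumes f: "bounded_linear f" and M: "subspace M" "closed M" and "C > 0"
    and C: "\<And>x. x \<in> M \<Longrightarrow> \<exists>x'\<in>M. f x' = f x \<and> norm x' \<le> C * norm (f x)"
  shows "closed (f ` M)"
proof -
  interpret f: bounded_linear f by fact
  have fM: "subspace (f ` M)" using M f.linear_axioms by (simp add: linear_subspace_image)
  have "\<exists>x\<in>M. norm x \<le> 2 * C * norm y \<and> norm (y - f x) \<le> norm y / 2" if y: "y \<in> closure (f ` M)" for y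
  proof (cases "y = 0")
    case True
    then show ?thesis using M by (intro bexI[of _ 0]) (auto simp: f.zero subspace_0)
  next
    case False
    then obtain x where x: "x \<in> M" "dist (f x) y < norm y / 2"
      using y closure_approachable[of y "f ` M"] by (metis imageE half_gt_zero zero_less_norm_iff)
    obtain x' where x': "x' \<in> M" "f x' = f x" "norm x' \<le> C * norm (f x)" using C[OF x(1)] by blast
    have 1: "norm (y - f x) < norm y / 2" using x by (simp add: dist_norm norm_minus_commute)
    have "norm (f x) \<le> norm y + norm (y - f x)" using norm_triangle_ineq4[of y "y - f x"] by simp
    then have "norm (f x) \<le> 2 * norm y" using 1 norm_ge_zero[of y] by linarith
    then have "C * norm (f x) \<le> C * (2 * norm y)" using \<open>C > 0\<close> by (intro mult_left_mono) auto
    then show ?thesis using x' 1 by (intro bexI[of _ x']) auto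
  qed
  note approx = this
  have "y \<in> f ` M" if "y \<in> closure (f ` M)" for y
  proof -
    have "\<exists>x\<in>M. f x = y \<and> norm x \<le> 2 * (2 * C) * norm y"
    proof (rule approximately_onto_imp_onto[OF f M(1) M(2) subspace_closure[OF fM] _ _ _ that])
      show "f x \<in> closure (f ` M)" if "x \<in> M" for x
        by (rule subsetD[OF closure_subset imageI[OF that]])
    qed (use \<open>C > 0\<close> approx in auto)
    then show ?thesis by blast
  qed
  then have "closure (f ` M) \<subseteq> f ` M" by (rule subsetI)
  then show ?thesis using closure_subset_eq by blast
qed

text \<open>Both gap conditions hold with \<open>\<delta> = C * cmod (a - b)\<close>. On the kernel
  of \<open>T - a\<close> the operator \<open>T - b\<close> is multiplication by
  \<open>a - b\<close>, so subtracting a small preimage corrects a kernel vector. In the range,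
  \<open>sh T b x'\<close> is compared with \<open>sh T a x'\<close> for a preimage
  \<open>x'\<close> of controlled norm.\<close>

lemma kato_stable:
  assumes T: "is_op scl T" and M: "csubspace scl M" "closed M" "T ` M \<subseteq> M" and kato: "kato_on M T"
  obtains \<epsilon> where "\<epsilon> > 0"
    "\<And>a. cmod a < \<epsilon> \<Longrightarrow> closed (sh T a ` M)"
    "\<And>a n x. cmod a < \<epsilon> \<Longrightarrow> x \<in> M \<Longrightarrow> sh T a x = 0 \<Longrightarrow> x \<in> (sh T a ^^ n) ` M"
    "\<And>a b. cmod a < \<epsilon> \<Longrightarrow> cmod b < \<epsilon> \<Longrightarrow> rdim {0} (kern_on M (sh T a)) = rdim {0} (kern_on M (sh T b))"
    "\<And>a b. cmod a < \<epsilon> \<Longrightarrow> cmod b < \<epsilon> \<Longrightarrow> rdim (sh T a ` M) M = rdim (sh T b ` M) M"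
proof -
  obtain \<epsilon> C K where \<epsilon>: "\<epsilon> > 0" and C: "C > 0" and KM: "K \<subseteq> M"
    and U: "\<And>a x. cmod a < \<epsilon> \<Longrightarrow> x \<in> M \<Longrightarrow> \<exists>x'\<in>M. sh T a x' = sh T a x \<and> norm x' \<le> C * norm (sh T a x)"
    and onK: "\<And>a. cmod a < \<epsilon> \<Longrightarrow> sh T a ` K = K"
    and kerK: "\<And>a x. cmod a < \<epsilon> \<Longrightarrow> x \<in> M \<Longrightarrow> sh T a x = 0 \<Longrightarrow> x \<in> K"
    using kato_uniform[OF assms] by metis
  have sM: "subspace M" using M by (simp add: csubspace_def)
  have lin: "linear (sh T a)" for a using T by (intro is_op_linear is_op_shift)
  have ker: "subspace (kern_on M (sh T a))" for a
    using csubspace_ker[OF is_op_shift[OF T] M(1)] by (rule csubspace_subspace)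
  have ran: "subspace (sh T a ` M)" for a using lin sM by (rule linear_subspace_image)
  have ranM: "sh T a ` M \<subseteq> M" for a using M by (intro shift_image)
  have diff: "sh T a x - sh T b x = scl (b - a) x" for a b x by (simp add: shift_apply scl_diff_left)
  have cl: "closed (sh T a ` M)" if "cmod a < \<epsilon>" for a
    using closed_range_if_bounded_modulus[OF is_op_bounded_linear[OF is_op_shift[OF T]] sM M(2) C] U that by blast
  \<comment> \<open>This distance is the step length for level \<open>k\<close>, both for kernels
    and for ranges.\<close>
  have small: "3 * (C * cmod (a - b)) < (1/5) ^ k" if "cmod (a - b) < (1/5) ^ k / (3 * C)" for a b k
    using that C by (simp add: field_simps)
  have kd: "rdim {0} (kern_on M (sh T a)) = rdim {0} (kern_on M (sh T b))" if ab: "cmod a < \<epsilon>" "cmod b < \<epsilon>" for a b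
  proof (rule enat_eqI_le)
    fix k
    have step: "enat k \<le> rdim {0} (kern_on M (sh T b))"
      if a: "cmod a < \<epsilon>" and b: "cmod b < \<epsilon>" and close: "cmod (a - b) < (1/5) ^ k / (3 * C)"
        and k: "enat k \<le> rdim {0} (kern_on M (sh T a))" for a b
    proof (rule le_rdim_of_small_gap[OF _ _ ker _ _ ker _ _ _ _ small[OF close] k])
      fix u assume u: "u \<in> kern_on M (sh T a)"
      then obtain x' where x': "x' \<in> M" "sh T b x' = sh T b u" "norm x' \<le> C * norm (sh T b u)" using U[OF b] by blast
      have "norm (sh T b u) = cmod (a - b) * norm u"
        using diff[of b u a] u by (simp add: norm_scl)
      then have "norm x' \<le> C * cmod (a - b) * norm u" using x'(3) by simp
      moreover have "u - x' \<in> kern_on M (sh T b)" using u x' sM by (auto simp: subspace_diff linear_diff[OF lin])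
      ultimately show "\<exists>u'\<in>kern_on M (sh T b). norm (u - u') \<le> C * cmod (a - b) * norm u"
        by (intro bexI[of _ "u - x'"]) auto
    qed (use C sM linear_0[OF lin] in \<open>auto simp: subspace_0\<close>)
    have \<eta>: "(1/5) ^ k / (3 * C) > 0" using C by simp
    have "enat k \<le> rdim {0} (kern_on M (sh T b))"
      if "cmod a < \<epsilon>" "cmod b < \<epsilon>" "enat k \<le> rdim {0} (kern_on M (sh T a))" for a b
      by (rule ball_propagate[where P = "\<lambda>a. enat k \<le> rdim {0} (kern_on M (sh T a))", OF \<eta> _ that])
         (rule step)
    then show "enat k \<le> rdim {0} (kern_on M (sh T a)) \<longleftrightarrow> enat k \<le> rdim {0} (kern_on M (sh T b))"
      using ab by blast
  qed
  have rd: "rdim (sh T a ` M) M = rdim (sh T b ` M) M" if ab: "cmod a < \<epsilon>" "cmod b < \<epsilon>" for a b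
  proof (rule enat_eqI_le)
    fix k
    have step: "enat k \<le> rdim (sh T b ` M) M"
      if a: "cmod a < \<epsilon>" and b: "cmod b < \<epsilon>" and close: "cmod (a - b) < (1/5) ^ k / (3 * C)"
        and k: "enat k \<le> rdim (sh T a ` M) M" for a b
    proof (rule le_rdim_of_small_gap[OF ran cl[OF a] sM ranM ran sM ranM _ _ _ small[OF close] k])
      fix v assume "v \<in> sh T b ` M"
      then obtain x' where x': "x' \<in> M" "sh T b x' = v" "norm x' \<le> C * norm v" using U[OF b] by blast
      have "norm (v - sh T a x') = cmod (a - b) * norm x'"
        using diff[of b x' a] x'(2) by (simp add: norm_scl)
      also have "\<dots> \<le> cmod (a - b) * (C * norm v)" using x'(3) by (intro mult_left_mono) auto
      finally show "\<exists>v'\<in>sh T a ` M. norm (v - v') \<le> C * cmod (a - b) * norm v"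
        using x'(1) by (intro bexI[of _ "sh T a x'"]) (auto simp: mult_ac)
    qed (use C in \<open>force+\<close>)
    have \<eta>: "(1/5) ^ k / (3 * C) > 0" using C by simp
    have "enat k \<le> rdim (sh T b ` M) M"
      if "cmod a < \<epsilon>" "cmod b < \<epsilon>" "enat k \<le> rdim (sh T a ` M) M" for a b
      by (rule ball_propagate[where P = "\<lambda>a. enat k \<le> rdim (sh T a ` M) M", OF \<eta> _ that])
         (rule step)
    then show "enat k \<le> rdim (sh T a ` M) M \<longleftrightarrow> enat k \<le> rdim (sh T b ` M) M"
      using ab by blast
  qed
  \<comment> \<open>Kernel vectors lie in \<open>K\<close>, which \<open>T - a\<close> maps onto
    itself, so they belong to every iterated range: the Kato condition persists on the disc.\<close>
  have kn: "x \<in> (sh T a ^^ n) ` M" if "cmod a < \<epsilon>" "x \<in> M" "sh T a x = 0" for a n x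
  proof -
    have "(sh T a ^^ n) ` K = K" by (induction n) (auto simp: funpow_Suc_image(1) onK[OF that(1)] simp del: funpow.simps(2))
    then show ?thesis using kerK[OF that] KM by blast
  qed
  show ?thesis using that[OF \<epsilon> cl kn kd rd] by blast
qed

section \<open>Riesz operators\<close>

text \<open>The iterated ranges need not contain the kernel, but adding this finite-dimensional
  space keeps them closed and does not alter the next image. The intersections \<open>D n\<close> of
  the kernel with the ranges decrease; from an index \<open>p\<close> of least dimension on they are
  constant, which is the Kato condition on the \<open>p\<close>-th range.\<close>

lemma semi_fredholm_upper_kato_part:
  assumes T: "is_op scl T" and N: "csubspace scl N" "closed N" "T ` N \<subseteq> N"
    and fin: "rdim {0} (kern_on N T) \<noteq> \<infinity>" and cl: "closed (T ` N)"
  obtains p where "closed ((T ^^ p) ` N)" "kato_on ((T ^^ p) ` N) T"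
proof -
  have sN: "subspace N" using N by (simp add: csubspace_def)
  have sR: "subspace ((T ^^ n) ` N)" for n
    by (rule csubspace_subspace[OF csubspace_image[OF is_op_funpow[OF T] N(1)]])
  have RN: "(T ^^ n) ` N \<subseteq> N" for n by (rule funpow_image_subset[OF N(3)])
  have lin: "linear T" by (rule is_op_linear[OF T])
  let ?K = "kern_on N T"
  have sK: "subspace ?K" by (rule csubspace_subspace[OF csubspace_ker[OF T N(1)]])
  obtain F where F: "finite F" "F \<subseteq> ?K" "?K \<subseteq> span ({0} \<union> F)" using fin by (rule rdim_attained)
  then have spF: "span F = ?K" using span_subspace[OF F(2) _ sK] by simp
  have clR: "closed ((T ^^ n) ` N)" for n
  proof (induction n)
    case (Suc n)
    let ?V = "span ((T ^^ n) ` N \<union> F)"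
    have sum: "?V = {x + y |x y. x \<in> (T ^^ n) ` N \<and> y \<in> ?K}"
      unfolding span_Un spF using sR[of n] by (simp add: span_eq_iff[THEN iffD2])
    have VN: "?V \<subseteq> N" using RN F(2) by (intro span_minimal[OF _ sN]) auto
    have "closed (T ` ?V)"
    proof (rule closed_image_containing_kernel[OF is_op_bounded_linear[OF T] sN N(2) cl])
      show "closed ?V" by (rule closed_span_Un_finite[OF F(1) sR Suc])
      show "x \<in> ?V" if "x \<in> N" "T x = 0" for x
        unfolding sum using that subspace_0[OF sR[of n]] by force
    qed (use VN in auto)
    moreover have "T ` ?V = T ` (T ^^ n) ` N"
    proof
      show "T ` ?V \<subseteq> T ` (T ^^ n) ` N"
        unfolding sum by (auto simp: linear_add[OF lin])
      show "T ` (T ^^ n) ` N \<subseteq> T ` ?V" by (intro image_mono) (auto intro: span_base)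
    qed
    ultimately show ?case by (simp only: funpow_Suc_image)
  qed (use N in simp)
  define D where "D n = ?K \<inter> (T ^^ n) ` N" for n
  have sD: "subspace (D n)" for n unfolding D_def by (rule subspace_inter[OF sK sR])
  have mono: "D n \<subseteq> D m" if "m \<le> n" for m n
    unfolding D_def using funpow_image_antimono[OF N(3) that] by auto
  have z: "{0} \<subseteq> D n" for n using subspace_0[OF sD] by simp
  have finD: "rdim {0} (D n) \<noteq> \<infinity>" for n
  proof -
    have "rdim {0} (D n) \<le> rdim {0} ?K"
      by (rule rdim_mono_right[OF _ sD sK z]) (auto simp: D_def)
    then show ?thesis using fin by (rule enat_le_finite)
  qed
  obtain p where p: "\<And>n. rdim {0} (D p) \<le> rdim {0} (D n)"
    using enat_sequence_attains_min[of "\<lambda>n. rdim {0} (D n)"] by blast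
  have stab: "D p \<subseteq> D n" if "p \<le> n" for n
  proof -
    have "rdim {0} (D p) = rdim {0} (D n) + rdim (D n) (D p)"
      by (rule rdim_chain[OF _ sD sD z mono[OF that]]) simp
    then have "rdim (D n) (D p) = 0" using p[of n] finD[of n] finD[of p]
      by (cases "rdim {0} (D n)"; cases "rdim (D n) (D p)") (auto simp: zero_enat_def)
    then show ?thesis using rdim_eq_0_iff[OF sD] by blast
  qed
  show ?thesis
  proof (rule that[OF clR])
    show "kato_on ((T ^^ p) ` N) T"
      unfolding kato_on_def
    proof (intro conjI allI)
      show "closed (T ` (T ^^ p) ` N)" using clR[of "Suc p"] by (simp only: funpow_Suc_image)
      fix n
      have "kern_on ((T ^^ p) ` N) T \<subseteq> D p" using RN[of p] by (auto simp: D_def)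
      also have "\<dots> \<subseteq> D (n + p)" by (rule stab) simp
      also have "\<dots> \<subseteq> (T ^^ (n + p)) ` N" by (simp add: D_def)
      also have "\<dots> = (T ^^ n) ` (T ^^ p) ` N" by (simp add: funpow_add image_comp)
      finally show "kern_on ((T ^^ p) ` N) T \<subseteq> (T ^^ n) ` (T ^^ p) ` N" .
    qed
  qed
qed

lemma finite_codim_iterate:
  assumes T: "is_op scl T" and N: "csubspace scl N" "T ` N \<subseteq> N"
    and fin: "rdim (T ` N) N \<noteq> \<infinity>"
  shows "rdim ((T ^^ n) ` N) N \<noteq> \<infinity>"
proof (induction n)
  case 0
  show ?case using csubspace_subspace[OF N(1)] by (simp add: zero_enat_def)
next
  case (Suc n)
  have sR: "subspace ((T ^^ n) ` N)" for n
    by (rule csubspace_subspace[OF csubspace_image[OF is_op_funpow[OF T] N(1)]])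
  have sub: "(T ^^ Suc n) ` N \<subseteq> T ` N"
    using image_mono[OF funpow_image_subset[OF N(2)]] unfolding funpow_Suc_image(1) .
  have "rdim ((T ^^ Suc n) ` N) N = rdim ((T ^^ Suc n) ` N) (T ` N) + rdim (T ` N) N"
    using rdim_chain[OF sR sR[of 1] csubspace_subspace[OF N(1)], of "Suc n"] sub N(2) by simp
  moreover have "rdim ((T ^^ Suc n) ` N) (T ` N) \<le> rdim ((T ^^ n) ` N) N"
    unfolding funpow_Suc_image(1) by (rule rdim_image_le[OF is_op_linear[OF T]])
  then have "rdim ((T ^^ Suc n) ` N) (T ` N) \<noteq> \<infinity>" using Suc by (rule enat_le_finite)
  ultimately show ?case using fin by (simp add: plus_eq_infty_iff_enat)
qed

text \<open>The kernel may be infinite dimensional, so the codimensions \<open>q n\<close> of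
  consecutive ranges take over the role of the kernel intersections. They decrease and are constant
  from \<open>p\<close> on; \<open>T\<close> then induces an isomorphism between consecutive
  quotients, which forces the kernel on \<open>R n\<close> into \<open>R (Suc n)\<close>.\<close>

lemma semi_fredholm_lower_kato_part:
  assumes T: "is_op scl T" and N: "csubspace scl N" "closed N" "T ` N \<subseteq> N"
    and fin: "rdim (T ` N) N \<noteq> \<infinity>"
  obtains p where "closed ((T ^^ p) ` N)" "kato_on ((T ^^ p) ` N) T"
proof -
  have sN: "subspace N" using N by (simp add: csubspace_def)
  have lin: "linear T" by (rule is_op_linear[OF T])
  define R where "R n = (T ^^ n) ` N" for n
  have sR: "subspace (R n)" for n
    unfolding R_def by (rule csubspace_subspace[OF csubspace_image[OF is_op_funpow[OF T] N(1)]])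
  have RN: "R n \<subseteq> N" for n unfolding R_def by (rule funpow_image_subset[OF N(3)])
  have RS: "R (Suc n) = T ` R n" for n unfolding R_def by (rule funpow_Suc_image)
  have mono: "R n \<subseteq> R m" if "m \<le> n" for m n
    unfolding R_def using funpow_image_antimono[OF N(3) that] .
  have finR: "rdim (R n) N \<noteq> \<infinity>" for n
    unfolding R_def by (rule finite_codim_iterate[OF T N(1,3) fin])
  have clR: "closed (R n)" for n
    unfolding R_def
    by (rule closed_image_of_finite_codim[OF is_op_bounded_linear[OF is_op_funpow[OF T]] sN N(2)])
       (use finR[of n] RN[of n] in \<open>simp_all add: R_def\<close>)
  define q where "q n = rdim (R (Suc n)) (R n)" for n
  have finq: "q n \<noteq> \<infinity>" for n
    unfolding q_def
    by (rule enat_le_finite[OF rdim_mono_right[OF sR sR sN mono RN] finR[of "Suc n"]]) simp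
  obtain p where p: "\<And>n. q p \<le> q n"
    using enat_sequence_attains_min[of q] by blast
  have qdec: "q (Suc n) \<le> q n" for n
    using rdim_image_le[OF lin, of "R (Suc n)" "R n"] by (simp add: q_def RS)
  have qp: "q n = q p" if "p \<le> n" for n
    using that
  proof (induction n rule: dec_induct)
    case (step n)
    then show ?case using qdec[of n] p[of "Suc n"] by simp
  qed simp
  have ker: "kern_on (R n) T \<subseteq> R (Suc n)" if "p \<le> n" for n
  proof -
    let ?K = "kern_on (R n) T"
    let ?V = "span (R (Suc n) \<union> ?K)"
    have V: "R (Suc n) \<subseteq> ?V" "?K \<subseteq> ?V" using span_superset[of "R (Suc n) \<union> ?K"] by auto
    have VR: "?V \<subseteq> R n" using mono[of n "Suc n"] by (intro span_minimal[OF _ sR]) auto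
    have eq: "T ` ?V = R (Suc (Suc n))"
    proof
      have "span (T ` ?K) \<subseteq> {0}" by (rule span_minimal) auto
      then show "T ` ?V \<subseteq> R (Suc (Suc n))"
        unfolding linear_span_image[OF lin, symmetric] image_Un RS[of "Suc n", symmetric]
        using subspace_0[OF sR] by (intro span_minimal[OF _ sR]) auto
      show "R (Suc (Suc n)) \<subseteq> T ` ?V" unfolding RS[of "Suc n"] using V(1) by (rule image_mono)
    qed
    have "q (Suc n) = rdim (T ` ?V) (T ` R n)" unfolding q_def eq RS[of n, symmetric] ..
    also have "\<dots> = rdim ?V (R n)"
      by (rule rdim_image[OF lin sR subspace_span VR]) (use V(2) in auto)
    finally have 1: "q (Suc n) = rdim ?V (R n)" .
    have "q n = rdim (R (Suc n)) ?V + rdim ?V (R n)"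
      unfolding q_def by (rule rdim_chain[OF sR subspace_span sR V(1) VR])
    then have "rdim (R (Suc n)) ?V = 0"
      using 1 qp[of n] qp[of "Suc n"] that finq[of p]
      by (cases "q p"; cases "rdim (R (Suc n)) ?V") (auto simp: zero_enat_def)
    then show ?thesis using rdim_eq_0_iff[OF sR] V(2) by blast
  qed
  have kern: "kern_on (R p) T \<subseteq> R (n + p)" for n
  proof (induction n)
    case (Suc n)
    then have "kern_on (R p) T \<subseteq> kern_on (R (n + p)) T" by auto
    also have "\<dots> \<subseteq> R (Suc n + p)" using ker[of "n + p"] by simp
    finally show ?case .
  qed auto
  show ?thesis
  proof (rule that)
    show "closed ((T ^^ p) ` N)" using clR[of p] by (simp only: R_def)
    show "kato_on ((T ^^ p) ` N) T"
      unfolding kato_on_def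
    proof (intro conjI allI)
      show "closed (T ` (T ^^ p) ` N)" using clR[of "Suc p"] by (simp only: funpow_Suc_image R_def)
      fix n
      have "(T ^^ n) ` (T ^^ p) ` N = R (n + p)" by (simp add: R_def funpow_add image_comp)
      then show "kern_on ((T ^^ p) ` N) T \<subseteq> (T ^^ n) ` (T ^^ p) ` N" using kern[of n] by (simp only: R_def)
    qed
  qed
qed

section \<open>Bijective shifts near a semi-Fredholm point\<close>

definition bij_on :: "'a set \<Rightarrow> ('a \<Rightarrow> 'a) \<Rightarrow> bool" where
  "bij_on N f \<longleftrightarrow> f ` N = N \<and> (\<forall>x\<in>N. f x = 0 \<longrightarrow> x = 0)"

lemma shift_funpow_commute:
  assumes "is_op scl T" shows "sh T a ((T ^^ n) x) = (T ^^ n) (sh T a x)"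
proof -
  have "(T ^^ n) (T x) = T ((T ^^ n) x)" by (metis funpow_swap1)
  then show ?thesis
    using is_op_funpow[OF assms, of n]
    by (simp add: shift_apply linear_diff[OF is_op_linear] is_op_scl)
qed

text \<open>Shifts commute with \<open>T ^^ p\<close>, so an approximant bijective on
  \<open>N\<close> is bijective on the \<open>p\<close>-th range \<open>?Y\<close>. Constant nullity
  and defect make all small shifts bijective on \<open>?Y\<close>, \<open>T\<close> itself included.
  The return to \<open>N\<close> excludes \<open>a = 0\<close>, since \<open>T\<close> is nilpotent
  on the remaining vectors.\<close>

lemma bijective_approximants:
  assumes T: "is_op scl T" and N: "csubspace scl N" "closed N" "T ` N \<subseteq> N"
    and p: "closed ((T ^^ p) ` N)" "kato_on ((T ^^ p) ` N) T"
    and approx: "\<And>\<epsilon>. \<epsilon> > 0 \<Longrightarrow> \<exists>a. cmod a < \<epsilon> \<and> bij_on N (sh T a)"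
  shows "bij_on ((T ^^ p) ` N) T"
    and "\<exists>\<epsilon>>0. \<forall>a. cmod a < \<epsilon> \<longrightarrow> a \<noteq> 0 \<longrightarrow> bij_on N (sh T a)"
proof -
  let ?Y = "(T ^^ p) ` N"
  have sN: "subspace N" using N by (simp add: csubspace_def)
  have cY: "csubspace scl ?Y" by (rule csubspace_image[OF is_op_funpow[OF T] N(1)])
  note sY = csubspace_subspace[OF cY]
  have YN: "?Y \<subseteq> N" by (rule funpow_image_subset[OF N(3)])
  have TY: "T ` ?Y \<subseteq> ?Y"
    using funpow_image_antimono[OF N(3), of p "Suc p"] by (simp only: funpow_Suc_image[symmetric])
  obtain \<epsilon> where \<epsilon>: "\<epsilon> > 0"
    and k: "\<And>a b. cmod a < \<epsilon> \<Longrightarrow> cmod b < \<epsilon> \<Longrightarrow> rdim {0} (kern_on ?Y (sh T a)) = rdim {0} (kern_on ?Y (sh T b))"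
    and r: "\<And>a b. cmod a < \<epsilon> \<Longrightarrow> cmod b < \<epsilon> \<Longrightarrow> rdim (sh T a ` ?Y) ?Y = rdim (sh T b ` ?Y) ?Y"
    by (rule kato_stable[OF T cY p(1) TY p(2)]) blast
  obtain a0 where a0: "cmod a0 < \<epsilon>" "bij_on N (sh T a0)" using approx[OF \<epsilon>] by blast
  have lin: "linear (sh T a)" for a using T by (intro is_op_linear is_op_shift)
  have "kern_on ?Y (sh T a0) \<subseteq> {0}" using a0(2) YN unfolding bij_on_def by blast
  then have k0: "rdim {0} (kern_on ?Y (sh T a0)) = 0" by (simp add: rdim_eq_0_iff)
  have "sh T a0 ` ?Y = (T ^^ p) ` sh T a0 ` N" by (simp add: image_image shift_funpow_commute[OF T])
  then have "sh T a0 ` ?Y = ?Y" using a0(2) by (simp add: bij_on_def)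
  then have r0: "rdim (sh T a0 ` ?Y) ?Y = 0" using sY by simp
  have bY: "bij_on ?Y (sh T a)" if a: "cmod a < \<epsilon>" for a
  proof -
    have "rdim {0} (kern_on ?Y (sh T a)) = 0" using k[OF a a0(1)] k0 by simp
    then have inj: "kern_on ?Y (sh T a) \<subseteq> {0}" by (simp add: rdim_eq_0_iff)
    have "rdim (sh T a ` ?Y) ?Y = 0" using r[OF a a0(1)] r0 by simp
    then have "?Y \<subseteq> sh T a ` ?Y" by (rule iffD1[OF rdim_eq_0_iff[OF linear_subspace_image[OF lin sY]]])
    then have "sh T a ` ?Y = ?Y" using shift_image[OF cY TY] by (intro equalityI)
    moreover have "x = 0" if "x \<in> ?Y" "sh T a x = 0" for x
      using subsetD[OF inj, of x] that by simp
    ultimately show ?thesis unfolding bij_on_def by simp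
  qed
  show bYT: "bij_on ?Y T" using bY[of 0] \<epsilon> by simp
  have "bij_on N (sh T a)" if a: "cmod a < \<epsilon>" "a \<noteq> 0" for a
    unfolding bij_on_def
  proof (intro conjI ballI impI equalityI)
    show "sh T a ` N \<subseteq> N" by (rule shift_image[OF N(1,3)])
    have sub: "subspace (sh T a ` N)" by (rule linear_subspace_image[OF lin sN])
    have csub: "csubspace scl (sh T a ` N)" by (rule csubspace_image[OF is_op_shift[OF T] N(1)])
    \<comment> \<open>Nilpotent vectors are reached because \<open>scl a z = T z - sh T a z\<close>,
      where \<open>T z\<close> is killed by a lower power.\<close>
    have nil: "\<forall>z\<in>N. (T ^^ j) z = 0 \<longrightarrow> z \<in> sh T a ` N" for j
    proof (induction j)
      case 0
      show ?case using subspace_0[OF sub] by simp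
    next
      case (Suc j)
      show ?case
      proof (intro ballI impI)
        fix z assume z: "z \<in> N" "(T ^^ Suc j) z = 0"
        then have "T z \<in> N" "(T ^^ j) (T z) = 0" using N(3) by (auto simp: funpow_swap1)
        then have "T z \<in> sh T a ` N" using Suc by blast
        then have "T z - sh T a z \<in> sh T a ` N" using z(1) by (intro subspace_diff[OF sub]) auto
        then have "scl a z \<in> sh T a ` N" by (simp add: shift_apply)
        then have "scl (inverse a) (scl a z) \<in> sh T a ` N" using csub unfolding csubspace_def by blast
        then show "z \<in> sh T a ` N" using a(2) by (simp add: scl_inverse)
      qed
    qed
    have Tp: "(T ^^ j) ` ?Y = ?Y" for j
      by (induction j) (use bYT in \<open>simp_all add: funpow_Suc_image(1) bij_on_def del: funpow.simps(2)\<close>)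
    show "N \<subseteq> sh T a ` N"
    proof
      fix y assume y: "y \<in> N"
      then have "(T ^^ p) y \<in> (T ^^ p) ` ?Y" using Tp[of p] by blast
      then obtain w where w: "w \<in> ?Y" "(T ^^ p) y = (T ^^ p) w" by (rule imageE)
      have "(T ^^ p) (y - w) = 0" using w linear_diff[OF is_op_linear[OF is_op_funpow[OF T]]] by simp
      moreover have "y - w \<in> N" using y w(1) YN by (intro subspace_diff[OF sN]) auto
      ultimately have "y - w \<in> sh T a ` N" using nil by blast
      moreover have "w \<in> sh T a ` ?Y" using bY[OF a(1)] w(1) by (simp add: bij_on_def)
      then have "w \<in> sh T a ` N" using image_mono[OF YN] by (rule subsetD[rotated])
      ultimately have "y - w + w \<in> sh T a ` N" by (rule subspace_add[OF sub])
      then show "y \<in> sh T a ` N" by simp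
    qed
    fix x assume x: "x \<in> N" "sh T a x = 0"
    have Tx: "T x = scl a x" using x by (simp add: shift_apply)
    \<comment> \<open>An eigenvector for a nonzero eigenvalue lies in every iterated range, so
      injectivity on \<open>?Y\<close> suffices.\<close>
    have "x \<in> (T ^^ j) ` N" for j
    proof (induction j)
      case (Suc j)
      then have "T x \<in> (T ^^ Suc j) ` N" unfolding funpow_Suc_image(1) by (rule imageI)
      then have "scl (inverse a) (scl a x) \<in> (T ^^ Suc j) ` N"
        using csubspace_image[OF is_op_funpow[OF T] N(1)] unfolding csubspace_def Tx by blast
      then show ?case using a(2) by (simp add: scl_inverse del: funpow.simps)
    qed (use x in simp)
    then have "x \<in> ?Y" .
    then show "x = 0" using bY[OF a(1)] x(2) unfolding bij_on_def by blast
  qed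
  then show "\<exists>\<epsilon>>0. \<forall>a. cmod a < \<epsilon> \<longrightarrow> a \<noteq> 0 \<longrightarrow> bij_on N (sh T a)" using \<epsilon> by blast
qed

text \<open>\<open>N\<close> is the direct sum of \<open>Z p\<close>, the vectors killed by
  \<open>T ^^ p\<close>, and the \<open>p\<close>-th range, on which \<open>T\<close> is bijective.
  Either finiteness hypothesis makes \<open>Z p\<close> finite dimensional, and there nullity equals
  defect.\<close>

lemma index_zero_if_bij_on_iterate:
  assumes T: "is_op scl T" and N: "csubspace scl N" "T ` N \<subseteq> N"
    and bij: "bij_on ((T ^^ p) ` N) T"
    and fin: "rdim {0} (kern_on N T) \<noteq> \<infinity> \<or> rdim (T ` N) N \<noteq> \<infinity>"
  shows "rdim {0} (kern_on N T) = rdim (T ` N) N" "rdim (T ` N) N \<noteq> \<infinity>"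
proof -
  let ?Y = "(T ^^ p) ` N"
  define Z where "Z j = kern_on N (T ^^ j)" for j
  have sN: "subspace N" using N by (simp add: csubspace_def)
  note lin = is_op_linear[OF T]
  note linp = is_op_linear[OF is_op_funpow[OF T]]
  have sY: "subspace ?Y" by (rule linear_subspace_image[OF linp sN])
  have sZ: "subspace (Z j)" for j
    unfolding Z_def by (rule csubspace_subspace[OF csubspace_ker[OF is_op_funpow[OF T] N(1)]])
  let ?K = "kern_on N T"
  have sK: "subspace ?K" by (rule csubspace_subspace[OF csubspace_ker[OF T N(1)]])
  have YN: "?Y \<subseteq> N" by (rule funpow_image_subset[OF N(2)])
  have ZN: "Z j \<subseteq> N" for j by (auto simp: Z_def)
  have TY: "T ` ?Y = ?Y" and injY: "\<And>y. y \<in> ?Y \<Longrightarrow> T y = 0 \<Longrightarrow> y = 0" using bij by (auto simp: bij_on_def)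
  have Tp: "(T ^^ j) ` ?Y = ?Y" for j
    by (induction j) (simp_all add: funpow_Suc_image(1) TY del: funpow.simps(2))
  have injp: "(T ^^ j) y = 0 \<longrightarrow> y = 0" if "y \<in> ?Y" for j y
    using that
  proof (induction j arbitrary: y)
    case (Suc j)
    then have "T y \<in> ?Y" using TY by blast
    then show ?case using Suc.IH[of "T y"] injY[OF Suc.prems] by (auto simp: funpow_swap1)
  qed simp
  have TZ: "T ` Z j \<subseteq> Z j" for j
  proof -
    have "(T ^^ j) (T x) = T ((T ^^ j) x)" for x by (metis funpow_swap1)
    then show ?thesis using N(2) linear_0[OF lin] by (auto simp: Z_def)
  qed
  have ZY: "Z p \<inter> ?Y = {0}"
    using injp subspace_0[OF sZ] subspace_0[OF sY] by (auto simp: Z_def)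
  have sum: "ssum (Z p) ?Y = N"
  proof
    show "ssum (Z p) ?Y \<subseteq> N" using ZN[of p] YN by (auto intro: subspace_add[OF sN])
    show "N \<subseteq> ssum (Z p) ?Y"
    proof
      fix y assume y: "y \<in> N"
      then have "(T ^^ p) y \<in> (T ^^ p) ` ?Y" using Tp[of p] by blast
      then obtain w where w: "w \<in> ?Y" "(T ^^ p) y = (T ^^ p) w" by (rule imageE)
      have "(T ^^ p) (y - w) = 0" using w linear_diff[OF linp] by simp
      moreover have "y - w \<in> N" using y w(1) YN by (intro subspace_diff[OF sN]) auto
      ultimately have "y - w \<in> Z p" by (simp add: Z_def)
      moreover have "y = (y - w) + w" by simp
      ultimately show "y \<in> ssum (Z p) ?Y" using w(1) by blast
    qed
  qed
  have KZ: "?K \<subseteq> Z p"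
  proof
    fix x assume x: "x \<in> ?K"
    then obtain z y where zy: "x = z + y" "z \<in> Z p" "y \<in> ?Y" using sum by blast
    have "T z \<in> Z p" "T y \<in> ?Y" using zy TZ TY by blast+
    have "T y = - T z" using x zy(1) linear_add[OF lin, of z y] by (simp add: eq_neg_iff_add_eq_0 add.commute)
    then have "T y \<in> Z p" using subspace_neg[OF sZ \<open>T z \<in> Z p\<close>] by simp
    then have "T y = 0" using ZY \<open>T y \<in> ?Y\<close> by blast
    then have "y = 0" using injY zy(3) by blast
    then show "x \<in> Z p" using zy by simp
  qed
  have T0K: "T ` ?K \<subseteq> {0}" by auto
  \<comment> \<open>A finite nullity bounds the kernels of all powers by induction; a finite defect
    bounds the codimension of the \<open>p\<close>-th range, which is the dimension of its
    complement \<open>Z p\<close>.\<close>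
  have finZ: "rdim {0} (Z p) \<noteq> \<infinity>"
    using fin
  proof
    assume fk: "rdim {0} ?K \<noteq> \<infinity>"
    have "rdim {0} (Z j) \<noteq> \<infinity>" for j
    proof (induction j)
      case 0
      have "Z 0 \<subseteq> {0}" by (auto simp: Z_def)
      then show ?case using rdim_eq_0_iff[of "{0}" "Z 0"] by (simp add: zero_enat_def)
    next
      case (Suc j)
      have KS: "?K \<subseteq> Z (Suc j)" using linear_0[OF linp] by (auto simp: Z_def funpow_Suc_right simp del: funpow.simps)
      have TZj: "T ` Z (Suc j) \<subseteq> Z j" using N(2) by (auto simp: Z_def funpow_swap1)
      have "rdim ?K (Z (Suc j)) = rdim (T ` ?K) (T ` Z (Suc j))"
        by (rule rdim_image[OF lin sZ sK KS, symmetric]) (use ZN in auto)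
      also have "T ` ?K = {0}" using T0K subspace_0[OF linear_subspace_image[OF lin sK]] by auto
      also have "rdim {0} (T ` Z (Suc j)) \<le> rdim {0} (Z j)"
        by (rule rdim_mono_right[OF _ linear_subspace_image[OF lin sZ] sZ _ TZj])
           (use subspace_0[OF linear_subspace_image[OF lin sZ]] in auto)
      finally have "rdim ?K (Z (Suc j)) \<noteq> \<infinity>" using Suc by (rule enat_le_finite)
      moreover have "rdim {0} (Z (Suc j)) = rdim {0} ?K + rdim ?K (Z (Suc j))"
        by (rule rdim_chain[OF _ sK sZ _ KS]) (use subspace_0[OF sK] in auto)
      ultimately show ?case using fk by (simp add: plus_eq_infty_iff_enat)
    qed
    then show ?thesis .
  next
    assume "rdim (T ` N) N \<noteq> \<infinity>"
    then have "rdim ?Y N \<noteq> \<infinity>" by (rule finite_codim_iterate[OF T N])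
    moreover have "rdim (ssum {0} ?Y) (ssum (Z p) ?Y) = rdim {0} (Z p) + rdim ?Y ?Y"
      by (rule rdim_ssum[OF _ sZ _ sY sY _ ZY]) (use subspace_0[OF sZ] in auto)
    moreover have "ssum {0} ?Y = ?Y" by auto
    ultimately show ?thesis using rdim_self[OF sY] unfolding sum by simp
  qed
  let ?TZ = "T ` Z p"
  have sTZ: "subspace ?TZ" by (rule linear_subspace_image[OF lin sZ])
  have a: "rdim {0} (Z p) = rdim {0} ?K + rdim ?K (Z p)"
    by (rule rdim_chain[OF _ sK sZ _ KZ]) (use subspace_0[OF sK] in auto)
  have b: "rdim {0} (Z p) = rdim {0} ?TZ + rdim ?TZ (Z p)"
    by (rule rdim_chain[OF _ sTZ sZ _ TZ]) (use subspace_0[OF sTZ] in auto)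
  have "rdim (T ` ?K) (T ` Z p) = rdim ?K (Z p)"
    by (rule rdim_image[OF lin sZ sK KZ]) (use ZN in auto)
  moreover have "T ` ?K = {0}" using T0K subspace_0[OF linear_subspace_image[OF lin sK]] by auto
  ultimately have c: "rdim {0} ?TZ = rdim ?K (Z p)" by simp
  have "T ` N = ssum ?TZ ?Y"
  proof -
    have "T ` ssum (Z p) ?Y = ssum (T ` Z p) (T ` ?Y)"
    proof
      show "T ` ssum (Z p) ?Y \<subseteq> ssum (T ` Z p) (T ` ?Y)"
        unfolding image_subset_iff using linear_add[OF lin] by blast
      show "ssum (T ` Z p) (T ` ?Y) \<subseteq> T ` ssum (Z p) ?Y"
      proof
        fix x assume "x \<in> ssum (T ` Z p) (T ` ?Y)"
        then obtain z y where "x = T z + T y" "z \<in> Z p" "y \<in> ?Y" by blast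
        then have "x = T (z + y)" "z + y \<in> ssum (Z p) ?Y" using linear_add[OF lin] by auto
        then show "x \<in> T ` ssum (Z p) ?Y" by (rule image_eqI)
      qed
    qed
    then show ?thesis unfolding sum TY .
  qed
  then have d: "rdim (T ` N) N = rdim ?TZ (Z p)"
    using rdim_ssum[OF sTZ sZ TZ sY sY order_refl ZY] rdim_self[OF sY] unfolding sum by simp
  show "rdim {0} ?K = rdim (T ` N) N" "rdim (T ` N) N \<noteq> \<infinity>"
    using a b c d finZ
    by (cases "rdim {0} (Z p)"; cases "rdim {0} ?K"; cases "rdim ?K (Z p)"; cases "rdim ?TZ (Z p)"; simp)+
qed

section \<open>Shifts of a Riesz operator\<close>

lemma fredholm_on_rdim:
  assumes S: "is_op scl S" and N: "csubspace scl N" and "fredholm_on N S"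
  shows "rdim {0} (kern_on N S) \<noteq> \<infinity>" "closed (S ` N)" "rdim (S ` N) N \<noteq> \<infinity>"
proof -
  show "rdim {0} (kern_on N S) \<noteq> \<infinity>" "closed (S ` N)"
    using assms(3) fin_dim_iff_rdim[OF csubspace_subspace[OF csubspace_ker[OF S N]]]
    by (auto simp: fredholm_on_def)
  obtain F where "finite F" "F \<subseteq> N" "N \<subseteq> span (S ` N \<union> F)" using assms(3) by (auto simp: fredholm_on_def)
  then have "rdim (S ` N) N \<le> card F" by (intro rdim_le_card)
  then show "rdim (S ` N) N \<noteq> \<infinity>" by (rule enat_le_finite) simp
qed

text \<open>For \<open>2 * B \<le> cmod \<mu>\<close> the vector
  \<open>- scl (inverse \<mu>) y\<close> solves the equation up to half the norm of
  \<open>y\<close>; the same bound excludes eigenvectors.\<close>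

lemma large_shift_bij_on:
  assumes T: "is_op scl T" and N: "csubspace scl N" "closed N" "T ` N \<subseteq> N"
  obtains r where "r > 0" "\<And>\<mu>. r \<le> cmod \<mu> \<Longrightarrow> bij_on N (sh T \<mu>)"
proof -
  obtain B where B: "B > 0" "\<And>x. norm (T x) \<le> norm x * B"
    using bounded_linear.pos_bounded[OF is_op_bounded_linear[OF T]] by blast
  have sN: "subspace N" by (rule csubspace_subspace[OF N(1)])
  show ?thesis
  proof (rule that[of "2 * B"])
    show "2 * B > 0" using B by simp
    fix \<mu> assume \<mu>: "2 * B \<le> cmod \<mu>"
    then have \<mu>0: "cmod \<mu> > 0" using B by linarith
    then have \<mu>1: "\<mu> \<noteq> 0" by auto
    have ap: "\<exists>x\<in>N. norm x \<le> inverse (cmod \<mu>) * norm y \<and> norm (y - sh T \<mu> x) \<le> norm y / 2" if y: "y \<in> N" for y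
    proof -
      define x where "x = - scl (inverse \<mu>) y"
      have xN: "x \<in> N" using y N(1) subspace_neg[OF sN] by (simp add: x_def csubspace_def)
      have nx: "norm x = inverse (cmod \<mu>) * norm y" by (simp add: x_def norm_scl norm_inverse)
      have "scl \<mu> (scl (inverse \<mu>) y) = y" using \<mu>1 by (simp flip: scl_mult)
      then have "scl \<mu> x = - y" by (simp add: x_def linear_neg[OF bounded_linear.linear[OF bounded_linear_scl]])
      then have "y - sh T \<mu> x = - T x" by (simp add: shift_apply)
      then have "norm (y - sh T \<mu> x) \<le> norm x * B" using B(2) by simp
      also have "\<dots> = B * inverse (cmod \<mu>) * norm y" by (simp add: nx)
      also have "\<dots> \<le> 1/2 * norm y" using \<mu> \<mu>0 by (intro mult_right_mono) (simp_all add: field_simps)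
      finally show ?thesis using xN nx by (intro bexI[of _ x]) simp_all
    qed
    have "\<exists>x\<in>N. sh T \<mu> x = y \<and> norm x \<le> 2 * inverse (cmod \<mu>) * norm y" if "y \<in> N" for y
      by (rule approximately_onto_imp_onto[OF is_op_bounded_linear[OF is_op_shift[OF T]] sN N(2) sN _ _ ap that])
         (use shift_in[OF N(1,3)] in simp_all)
    then have "N \<subseteq> sh T \<mu> ` N" by blast
    then have "sh T \<mu> ` N = N" using shift_image[OF N(1,3)] by blast
    moreover have "x = 0" if "sh T \<mu> x = 0" for x
    proof -
      have "cmod \<mu> * norm x = norm (T x)" using that by (simp add: shift_apply flip: norm_scl)
      also have "\<dots> \<le> norm x * B" by (rule B(2))
      also have "\<dots> \<le> norm x * (cmod \<mu> / 2)" using \<mu> by (intro mult_left_mono) auto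
      finally have "norm x * cmod \<mu> \<le> 0" by simp
      then show ?thesis using \<mu>0 by (simp add: mult_le_0_iff)
    qed
    ultimately show "bij_on N (sh T \<mu>)" unfolding bij_on_def by blast
  qed
qed

text \<open>The conclusion includes 0, where \<open>T\<close> need not be Fredholm on
  \<open>N\<close>, because 0 is a limit of nonzero points. This makes 0 accessible whenever
  \<open>T\<close> happens to be semi-Fredholm on \<open>N\<close>.\<close>

lemma riesz_bij_on_dense:
  assumes T: "is_op scl T" and N: "csubspace scl N" "closed N" "T ` N \<subseteq> N" and riesz: "riesz_on scl N T"
  shows "closure {\<mu>. bij_on N (sh T \<mu>)} = UNIV"
proof -
  define A where "A = {\<mu>. bij_on N (sh T \<mu>)}"
  let ?\<Omega> = "- {0::complex}"
  have isol: "\<exists>\<epsilon>>0. \<forall>a. cmod a < \<epsilon> \<longrightarrow> a \<noteq> 0 \<longrightarrow> \<mu> + a \<in> A" if \<mu>: "\<mu> \<in> closure A" "\<mu> \<noteq> 0" for \<mu>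
  proof -
    have "fredholm_on N (sh T \<mu>)" using riesz \<mu>(2) by (simp add: riesz_on_def)
    note fr = fredholm_on_rdim[OF is_op_shift[OF T] N(1) this]
    obtain p where p: "closed ((sh T \<mu> ^^ p) ` N)" "kato_on ((sh T \<mu> ^^ p) ` N) (sh T \<mu>)"
      by (rule semi_fredholm_upper_kato_part[OF is_op_shift[OF T] N(1,2) shift_image[OF N(1,3)] fr(1,2)])
    have "\<exists>a. cmod a < \<epsilon> \<and> bij_on N (sh (sh T \<mu>) a)" if "\<epsilon> > 0" for \<epsilon>
    proof -
      obtain \<nu> where "\<nu> \<in> A" "dist \<nu> \<mu> < \<epsilon>" using \<mu>(1) \<open>\<epsilon> > 0\<close> unfolding closure_approachable by blast
      then show ?thesis by (intro exI[of _ "\<nu> - \<mu>"]) (simp add: A_def shift_shift dist_norm)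
    qed
    from bijective_approximants(2)[OF is_op_shift[OF T] N(1,2) shift_image[OF N(1,3)] p this]
    show ?thesis by (simp add: A_def shift_shift)
  qed
  define E where "E = ?\<Omega> \<inter> closure A"
  have "openin (top_of_set ?\<Omega>) E"
  proof -
    have "open E"
      unfolding open_contains_ball
    proof
      fix \<mu> assume "\<mu> \<in> E"
      then have \<mu>: "\<mu> \<in> closure A" "\<mu> \<noteq> 0" by (auto simp: E_def)
      then obtain \<epsilon> where \<epsilon>: "\<epsilon> > 0" "\<And>a. cmod a < \<epsilon> \<Longrightarrow> a \<noteq> 0 \<Longrightarrow> \<mu> + a \<in> A" using isol by blast
      have "ball \<mu> (min \<epsilon> (cmod \<mu>)) \<subseteq> E"
      proof
        fix \<nu> assume \<nu>: "\<nu> \<in> ball \<mu> (min \<epsilon> (cmod \<mu>))"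
        then have "cmod (\<nu> - \<mu>) < \<epsilon>" "\<nu> \<noteq> 0" by (auto simp: dist_norm norm_minus_commute)
        moreover have "\<nu> \<in> closure A"
        proof (cases "\<nu> = \<mu>")
          case False
          then have "\<nu> \<in> A" using \<epsilon>(2)[of "\<nu> - \<mu>"] \<open>cmod (\<nu> - \<mu>) < \<epsilon>\<close> by simp
          then show ?thesis using closure_subset by (rule subsetD[rotated])
        qed (use \<mu> in simp)
        ultimately show "\<nu> \<in> E" by (simp add: E_def)
      qed
      then show "\<exists>e>0. ball \<mu> e \<subseteq> E" using \<epsilon> \<mu> by (intro exI[of _ "min \<epsilon> (cmod \<mu>)"]) simp
    qed
    moreover have "E \<subseteq> ?\<Omega>" by (simp add: E_def)
    ultimately show ?thesis by (intro open_subset)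
  qed
  moreover have "closedin (top_of_set ?\<Omega>) E" unfolding E_def by (rule closedin_closed_Int) simp
  moreover have "connected ?\<Omega>" by (rule connected_punctured_universe) simp
  moreover have "E \<noteq> {}"
  proof -
    obtain r where r: "r > 0" "\<And>\<mu>. r \<le> cmod \<mu> \<Longrightarrow> bij_on N (sh T \<mu>)" using large_shift_bij_on[OF T N] by blast
    then have "of_real r \<in> A" "of_real r \<in> ?\<Omega>" by (auto simp: A_def)
    then have "of_real r \<in> E" unfolding E_def using closure_subset[of A] by blast
    then show ?thesis by blast
  qed
  ultimately have "E = ?\<Omega>" unfolding connected_clopen by blast
  then have "?\<Omega> \<subseteq> closure A" by (auto simp: E_def)
  then have "closure ?\<Omega> \<subseteq> closure A" by (intro closure_minimal) simp_all
  moreover have "closure ?\<Omega> = UNIV" by (simp add: closure_complement)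
  ultimately show ?thesis by (simp add: A_def top.extremum_unique)
qed

text \<open>\<open>sf\<close> is automatic for \<open>\<mu> \<noteq> 0\<close> and is extra
  information at 0. It supplies a Kato restriction to an iterated range, which the density of
  bijective shifts makes bijective. Index 0 follows, and kernels and ranges become stable at the
  same power.\<close>

lemma riesz_semi_fredholm_is_browder:
  assumes T: "is_op scl T" and N: "csubspace scl N" "closed N" "T ` N \<subseteq> N" and riesz: "riesz_on scl N T"
    and sf: "rdim {0} (kern_on N (sh T \<mu>)) \<noteq> \<infinity> \<and> closed (sh T \<mu> ` N) \<or> rdim (sh T \<mu> ` N) N \<noteq> \<infinity>"
  shows "rdim {0} (kern_on N (sh T \<mu>)) = rdim (sh T \<mu> ` N) N" "rdim (sh T \<mu> ` N) N \<noteq> \<infinity>"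
    "\<exists>p. (\<forall>x\<in>N. (sh T \<mu> ^^ Suc p) x = 0 \<longrightarrow> (sh T \<mu> ^^ p) x = 0) \<and> (sh T \<mu> ^^ Suc p) ` N = (sh T \<mu> ^^ p) ` N"
proof -
  let ?S = "sh T \<mu>"
  have S: "is_op scl ?S" by (rule is_op_shift[OF T])
  have SN: "?S ` N \<subseteq> N" by (rule shift_image[OF N(1,3)])
  obtain p where p: "closed ((?S ^^ p) ` N)" "kato_on ((?S ^^ p) ` N) ?S"
    using sf
  proof
    assume "rdim {0} (kern_on N ?S) \<noteq> \<infinity> \<and> closed (?S ` N)"
    then show thesis using semi_fredholm_upper_kato_part[OF S N(1,2) SN] that by blast
  next
    assume "rdim (?S ` N) N \<noteq> \<infinity>"
    then show thesis using semi_fredholm_lower_kato_part[OF S N(1,2) SN] that by blast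
  qed
  have "\<exists>a. cmod a < \<epsilon> \<and> bij_on N (sh ?S a)" if "\<epsilon> > 0" for \<epsilon>
  proof -
    have "\<mu> \<in> closure {\<mu>. bij_on N (sh T \<mu>)}" using riesz_bij_on_dense[OF T N riesz] by simp
    then obtain \<nu> where "bij_on N (sh T \<nu>)" "dist \<nu> \<mu> < \<epsilon>" using \<open>\<epsilon> > 0\<close> unfolding closure_approachable by blast
    then show ?thesis by (intro exI[of _ "\<nu> - \<mu>"]) (simp add: shift_shift dist_norm)
  qed
  from bijective_approximants(1)[OF S N(1,2) SN p this] have bij: "bij_on ((?S ^^ p) ` N) ?S" .
  have fin: "rdim {0} (kern_on N ?S) \<noteq> \<infinity> \<or> rdim (?S ` N) N \<noteq> \<infinity>" using sf by blast
  show "rdim {0} (kern_on N ?S) = rdim (?S ` N) N" "rdim (?S ` N) N \<noteq> \<infinity>"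
    using index_zero_if_bij_on_iterate[OF S N(1) SN bij fin] by blast+
  show "\<exists>p. (\<forall>x\<in>N. (?S ^^ Suc p) x = 0 \<longrightarrow> (?S ^^ p) x = 0) \<and> (?S ^^ Suc p) ` N = (?S ^^ p) ` N"
  proof (intro exI conjI)
    show "(?S ^^ Suc p) ` N = (?S ^^ p) ` N" using bij by (simp add: funpow_Suc_image(1) bij_on_def del: funpow.simps)
    show "\<forall>x\<in>N. (?S ^^ Suc p) x = 0 \<longrightarrow> (?S ^^ p) x = 0"
      using bij by (simp add: bij_on_def)
  qed
qed

end

section \<open>Operators with a GKRD\<close>

locale gkrd = complex_banach scl for scl :: "complex \<Rightarrow> 'a::banach \<Rightarrow> 'a" +
  fixes T :: "'a \<Rightarrow> 'a" and M N :: "'a set"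
  assumes T: "is_op scl T"
    and M: "csubspace scl M" "closed M" "T ` M \<subseteq> M"
    and N: "csubspace scl N" "closed N" "T ` N \<subseteq> N"
    and MN: "M \<inter> N = {0}" and split: "\<exists>m\<in>M. \<exists>n\<in>N. x = m + n"
    and kato: "kato_on M T" and riesz: "riesz_on scl N T"
begin

lemma subspace_M: "subspace M" and subspace_N: "subspace N"
  using M N by (auto simp: csubspace_def)

lemma ssum_MN: "ssum M N = UNIV"
  using split by blast

lemma components_zero: "m \<in> M \<Longrightarrow> n \<in> N \<Longrightarrow> m + n = 0 \<Longrightarrow> m = 0 \<and> n = 0"
proof -
  assume mn: "m \<in> M" "n \<in> N" "m + n = 0"
  then have "m = - n" by (simp add: eq_neg_iff_add_eq_0)
  then have "m \<in> N" using mn subspace_neg[OF subspace_N] by simp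
  then have "m = 0" using mn MN by blast
  then show "m = 0 \<and> n = 0" using mn by simp
qed

lemma components_zero_image:
  assumes "linear f" "f ` M \<subseteq> M" "f ` N \<subseteq> N" "m \<in> M" "n \<in> N" "f (m + n) = 0"
  shows "f m = 0" "f n = 0"
  using components_zero[of "f m" "f n"] assms by (auto simp: linear_add)

lemma kern_split:
  assumes f: "linear f" "f ` M \<subseteq> M" "f ` N \<subseteq> N"
  shows "ker f = ssum (kern_on M f) (kern_on N f)"
proof
  show "ker f \<subseteq> ssum (kern_on M f) (kern_on N f)"
  proof
    fix x assume x: "x \<in> ker f"
    obtain m n where mn: "m \<in> M" "n \<in> N" "x = m + n" using split by blast
    then have "f m = 0" "f n = 0" using components_zero_image[OF f mn(1,2)] x by (auto simp: ker_def)
    then show "x \<in> ssum (kern_on M f) (kern_on N f)" using mn by blast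
  qed
  show "ssum (kern_on M f) (kern_on N f) \<subseteq> ker f" using linear_add[OF f(1)] by (auto simp: ker_def)
qed

lemma range_split:
  assumes f: "linear f"
  shows "range f = ssum (f ` M) (f ` N)"
proof
  show "range f \<subseteq> ssum (f ` M) (f ` N)"
  proof
    fix y assume "y \<in> range f"
    then obtain x where "y = f x" by blast
    moreover obtain m n where "m \<in> M" "n \<in> N" "x = m + n" using split by blast
    ultimately have "y = f m + f n" "f m \<in> f ` M" "f n \<in> f ` N" by (simp_all add: linear_add[OF f])
    then show "y \<in> ssum (f ` M) (f ` N)" by blast
  qed
  show "ssum (f ` M) (f ` N) \<subseteq> range f"
  proof
    fix y assume "y \<in> ssum (f ` M) (f ` N)"
    then obtain m n where "y = f m + f n" by blast
    then have "y = f (m + n)" by (simp add: linear_add[OF f])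
    then show "y \<in> range f" by blast
  qed
qed

lemma rdim_ker_split:
  assumes f: "is_op scl f" "f ` M \<subseteq> M" "f ` N \<subseteq> N"
  shows "rdim {0} (ker f) = rdim {0} (kern_on M f) + rdim {0} (kern_on N f)"
proof -
  have s: "subspace (kern_on M f)" "subspace (kern_on N f)"
    using csubspace_ker[OF f(1)] M(1) N(1) by (auto simp: csubspace_def)
  have "rdim (ssum {0} {0}) (ssum (kern_on M f) (kern_on N f)) = rdim {0} (kern_on M f) + rdim {0} (kern_on N f)"
  proof (rule rdim_ssum[OF _ s(1) _ _ s(2)])
    have "0 \<in> kern_on M f" "0 \<in> kern_on N f" using subspace_0 s by blast+
    then show "{0} \<subseteq> kern_on M f" "{0} \<subseteq> kern_on N f" "kern_on M f \<inter> kern_on N f = {0}" using MN by auto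
  qed simp_all
  then show ?thesis unfolding kern_split[OF is_op_linear[OF f(1)] f(2,3)] by simp
qed

lemma rdim_range_split:
  assumes f: "is_op scl f" "f ` M \<subseteq> M" "f ` N \<subseteq> N"
  shows "rdim (range f) UNIV = rdim (f ` M) M + rdim (f ` N) N"
  using rdim_ssum[OF linear_subspace_image[OF is_op_linear[OF f(1)] subspace_M] subspace_M f(2)
      linear_subspace_image[OF is_op_linear[OF f(1)] subspace_N] subspace_N f(3) MN]
  unfolding range_split[OF is_op_linear[OF f(1)]] ssum_MN .

text \<open>Addition maps \<open>M \<times> N\<close> onto the whole space with trivial kernel, so
  the image of the closed subspace \<open>A \<times> B\<close> is closed.\<close>

lemma closed_ssum:
  assumes A: "subspace A" "closed A" "A \<subseteq> M" and B: "subspace B" "closed B" "B \<subseteq> N"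
  shows "closed (ssum A B)"
proof -
  let ?h = "\<lambda>p::'a \<times> 'a. fst p + snd p"
  have h: "bounded_linear ?h" by (intro bounded_linear_add bounded_linear_fst bounded_linear_snd)
  have img: "?h ` (X \<times> Y) = ssum X Y" for X Y :: "'a set" by force
  have "closed (?h ` (A \<times> B))"
  proof (rule closed_image_containing_kernel[OF h, of "M \<times> N"])
    show "closed (?h ` (M \<times> N))" unfolding img ssum_MN by simp
    show "x \<in> A \<times> B" if "x \<in> M \<times> N" "?h x = 0" for x
      using components_zero[of "fst x" "snd x"] that subspace_0[OF A(1)] subspace_0[OF B(1)] by (cases x) auto
  qed (use A B M N subspace_M subspace_N in \<open>auto simp: subspace_Times closed_Times\<close>)
  then show ?thesis unfolding img .
qed

lemma closed_range_iff:
  assumes f: "is_op scl f" "f ` M \<subseteq> M" "f ` N \<subseteq> N"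
  shows "closed (range f) \<longleftrightarrow> closed (f ` M) \<and> closed (f ` N)"
proof
  note lin = is_op_linear[OF f(1)]
  have sub: "subspace (f ` M)" "subspace (f ` N)"
    using lin subspace_M subspace_N by (auto intro: linear_subspace_image)
  have eM: "f ` M = range f \<inter> M"
  proof
    show "range f \<inter> M \<subseteq> f ` M"
    proof
      fix y assume y: "y \<in> range f \<inter> M"
      then obtain m n where mn: "m \<in> M" "n \<in> N" "y = f m + f n" unfolding range_split[OF lin] by blast
      have "f m - y \<in> M" using mn(1) y f(2) by (intro subspace_diff[OF subspace_M]) auto
      moreover have "f n \<in> N" "(f m - y) + f n = 0" using mn f(3) by auto
      ultimately have "f m - y = 0" using components_zero by blast
      then have "y = f m" by simp
      then show "y \<in> f ` M" using mn(1) by (rule image_eqI)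
    qed
  qed (use f in auto)
  have eN: "f ` N = range f \<inter> N"
  proof
    show "range f \<inter> N \<subseteq> f ` N"
    proof
      fix y assume y: "y \<in> range f \<inter> N"
      then obtain m n where mn: "m \<in> M" "n \<in> N" "y = f m + f n" unfolding range_split[OF lin] by blast
      have "f n - y \<in> N" using mn(2) y f(3) by (intro subspace_diff[OF subspace_N]) auto
      moreover have "f m \<in> M" "f m + (f n - y) = 0" using mn f(2) by auto
      ultimately have "f n - y = 0" using components_zero by blast
      then have "y = f n" by simp
      then show "y \<in> f ` N" using mn(2) by (rule image_eqI)
    qed
  qed (use f in auto)
  show "closed (f ` M) \<and> closed (f ` N)" if "closed (range f)"
    unfolding eM eN using that M(2) N(2) by (simp add: closed_Int)
  show "closed (range f)" if "closed (f ` M) \<and> closed (f ` N)"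
    unfolding range_split[OF lin] using that sub f(2,3) by (intro closed_ssum) auto
qed

end

text \<open>What membership of \<open>T - a\<close> in a class says about nullity \<open>\<alpha>\<close> and defect \<open>\<beta>\<close> of its Kato part.\<close>

fun restricted_class :: "op_class \<Rightarrow> enat \<Rightarrow> enat \<Rightarrow> bool" where
  "restricted_class B_plus \<alpha> \<beta> \<longleftrightarrow> \<alpha> = 0"
| "restricted_class B_minus \<alpha> \<beta> \<longleftrightarrow> \<beta> = 0"
| "restricted_class B_class \<alpha> \<beta> \<longleftrightarrow> \<alpha> = 0 \<and> \<beta> = 0"
| "restricted_class Phi_plus \<alpha> \<beta> \<longleftrightarrow> \<alpha> \<noteq> \<infinity>"
| "restricted_class Phi_minus \<alpha> \<beta> \<longleftrightarrow> \<beta> \<noteq> \<infinity>"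
| "restricted_class Phi_class \<alpha> \<beta> \<longleftrightarrow> \<alpha> \<noteq> \<infinity> \<and> \<beta> \<noteq> \<infinity>"
| "restricted_class W_plus \<alpha> \<beta> \<longleftrightarrow> \<alpha> \<noteq> \<infinity> \<and> \<alpha> \<le> \<beta>"
| "restricted_class W_minus \<alpha> \<beta> \<longleftrightarrow> \<beta> \<noteq> \<infinity> \<and> \<beta> \<le> \<alpha>"
| "restricted_class W_class \<alpha> \<beta> \<longleftrightarrow> \<beta> \<noteq> \<infinity> \<and> \<alpha> = \<beta>"

section \<open>Operator classes expressed by nullity and defect\<close>

context complex_banach
begin

lemma subspace_ker: "is_op scl S \<Longrightarrow> subspace (ker S)"
  using csubspace_ker[of S UNIV] by (simp add: ker_def csubspace_def)

lemma upper_semi_fredholm_iff: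
  "is_op scl S \<Longrightarrow> upper_semi_fredholm S \<longleftrightarrow> rdim {0} (ker S) \<noteq> \<infinity> \<and> closed (range S)"
  using fin_dim_iff_rdim[OF subspace_ker] by (auto simp: upper_semi_fredholm_def)

lemma lower_semi_fredholm_iff: "lower_semi_fredholm S \<longleftrightarrow> rdim (range S) UNIV \<noteq> \<infinity>"
  unfolding lower_semi_fredholm_def by (rule fin_codim_iff_rdim)

text \<open>\<open>dim\<close> and \<open>codim\<close> are natural numbers and carry no information
  in the infinite case. The guard in the definition excludes exactly the case in which comparison
  with \<infinity> is trivially true.\<close>

lemma weyl_upper_iff:
  assumes S: "is_op scl S"
  shows "weyl_upper S \<longleftrightarrow> rdim {0} (ker S) \<noteq> \<infinity> \<and> closed (range S) \<and> rdim {0} (ker S) \<le> rdim (range S) UNIV"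
proof (cases "rdim {0} (ker S) = \<infinity>")
  case True
  then show ?thesis by (simp add: weyl_upper_def upper_semi_fredholm_iff[OF S])
next
  case False
  then have "rdim {0} (ker S) = dim (ker S)" by (rule rdim_eq_dim[OF subspace_ker[OF S]])
  then show ?thesis
    using rdim_eq_codim[of "range S"]
    by (cases "rdim (range S) UNIV = \<infinity>")
       (simp_all add: weyl_upper_def upper_semi_fredholm_iff[OF S] fin_codim_iff_rdim)
qed

lemma weyl_lower_iff:
  assumes S: "is_op scl S"
  shows "weyl_lower S \<longleftrightarrow> rdim (range S) UNIV \<noteq> \<infinity> \<and> rdim (range S) UNIV \<le> rdim {0} (ker S)"
proof (cases "rdim (range S) UNIV = \<infinity>")
  case True
  then show ?thesis by (simp add: weyl_lower_def lower_semi_fredholm_iff)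
next
  case False
  then have "rdim (range S) UNIV = codim (range S)" by (rule rdim_eq_codim)
  then show ?thesis
    using rdim_eq_dim[OF subspace_ker[OF S]]
    by (cases "rdim {0} (ker S) = \<infinity>")
       (simp_all add: weyl_lower_def lower_semi_fredholm_iff fin_dim_iff_rdim[OF subspace_ker[OF S]])
qed

lemma weyl_iff:
  assumes S: "is_op scl S"
  shows "weyl S \<longleftrightarrow> rdim {0} (ker S) \<noteq> \<infinity> \<and> rdim {0} (ker S) = rdim (range S) UNIV \<and> closed (range S)"
proof (cases "rdim {0} (ker S) = \<infinity> \<or> rdim (range S) UNIV = \<infinity>")
  case True
  then show ?thesis by (auto simp: weyl_def fredholm_def lower_semi_fredholm_iff upper_semi_fredholm_iff[OF S])
next
  case False
  then have "rdim (range S) UNIV = codim (range S)" "rdim {0} (ker S) = dim (ker S)"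
    using rdim_eq_codim rdim_eq_dim[OF subspace_ker[OF S]] by blast+
  then show ?thesis
    by (auto simp: weyl_def fredholm_def lower_semi_fredholm_iff upper_semi_fredholm_iff[OF S])
qed

lemma kernel_zero_iff: "is_op scl S \<Longrightarrow> rdim {0} (kern_on V S) = 0 \<longleftrightarrow> (\<forall>x\<in>V. S x = 0 \<longrightarrow> x = 0)"
  using rdim_eq_0_iff[of "{0}" "kern_on V S"] by auto

lemma range_full_iff:
  assumes "is_op scl S" "subspace V" "S ` V \<subseteq> V" shows "rdim (S ` V) V = 0 \<longleftrightarrow> S ` V = V"
  using rdim_eq_0_iff[OF linear_subspace_image[OF is_op_linear[OF assms(1)] assms(2)], of V] assms(3) by auto

end

context gkrd
begin

abbreviation "\<alpha> V a \<equiv> rdim {0} (kern_on V (sh T a))"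
abbreviation "\<beta> V a \<equiv> rdim (sh T a ` V) V"

lemma is_op_sh: "is_op scl (sh T a)" and shift_M: "sh T a ` M \<subseteq> M" and shift_N: "sh T a ` N \<subseteq> N"
  by (rule is_op_shift[OF T], rule shift_image[OF M(1,3)], rule shift_image[OF N(1,3)])

lemma shift_funpow_M: "(sh T a ^^ n) ` M \<subseteq> M" and shift_funpow_N: "(sh T a ^^ n) ` N \<subseteq> N"
  by (rule funpow_image_subset[OF shift_M], rule funpow_image_subset[OF shift_N])

lemma riesz_part:
  assumes "a \<noteq> 0"
  shows "closed (sh T a ` N)" "\<alpha> N a = \<beta> N a" "\<beta> N a \<noteq> \<infinity>"
    "\<exists>p. (\<forall>x\<in>N. (sh T a ^^ Suc p) x = 0 \<longrightarrow> (sh T a ^^ p) x = 0) \<and> (sh T a ^^ Suc p) ` N = (sh T a ^^ p) ` N"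
proof -
  have "fredholm_on N (sh T a)" using riesz assms by (simp add: riesz_on_def)
  note fr = fredholm_on_rdim[OF is_op_sh N(1) this]
  show "closed (sh T a ` N)" by (rule fr)
  from fr have "\<alpha> N a \<noteq> \<infinity> \<and> closed (sh T a ` N) \<or> \<beta> N a \<noteq> \<infinity>" by blast
  note riesz_semi_fredholm_is_browder[OF T N riesz this]
  then show "\<alpha> N a = \<beta> N a" "\<beta> N a \<noteq> \<infinity>"
    "\<exists>p. (\<forall>x\<in>N. (sh T a ^^ Suc p) x = 0 \<longrightarrow> (sh T a ^^ p) x = 0) \<and> (sh T a ^^ Suc p) ` N = (sh T a ^^ p) ` N"
    by blast+
qed

lemmas ker_sum = rdim_ker_split[OF is_op_sh shift_M shift_N] and range_sum = rdim_range_split[OF is_op_sh shift_M shift_N]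
  and closed_range = closed_range_iff[OF is_op_sh shift_M shift_N]

text \<open>Semi-Fredholmness on the whole space descends to \<open>N\<close>, so the index on
  \<open>N\<close> vanishes even for \<open>a = 0\<close>.\<close>

lemma riesz_part_semi_fredholm:
  assumes "rdim {0} (ker (sh T a)) \<noteq> \<infinity> \<and> closed (range (sh T a)) \<or> rdim (range (sh T a)) UNIV \<noteq> \<infinity>"
  shows "\<alpha> N a = \<beta> N a" "\<beta> N a \<noteq> \<infinity>"
proof -
  have "\<alpha> N a \<noteq> \<infinity> \<and> closed (sh T a ` N) \<or> \<beta> N a \<noteq> \<infinity>"
    using assms unfolding ker_sum range_sum closed_range by auto
  from riesz_semi_fredholm_is_browder(1,2)[OF T N riesz this]
  show "\<alpha> N a = \<beta> N a" "\<beta> N a \<noteq> \<infinity>" .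
qed

text \<open>A kernel vector in \<open>M\<close> is the \<open>p\<close>-th image of some
  \<open>m\<close>. Then \<open>m\<close> is killed by the power \<open>Suc p\<close>, hence by the
  power \<open>p\<close>, and the vector is 0.\<close>

lemma finite_ascent_imp_injective:
  assumes kM: "\<And>n x. x \<in> M \<Longrightarrow> sh T a x = 0 \<Longrightarrow> x \<in> (sh T a ^^ n) ` M" and "finite_ascent (sh T a)"
  shows "\<alpha> M a = 0"
  unfolding kernel_zero_iff[OF is_op_sh]
proof (intro ballI impI)
  obtain p where p: "ker (sh T a ^^ p) = ker (sh T a ^^ Suc p)" using assms(2) by (auto simp: finite_ascent_def)
  fix x assume x: "x \<in> M" "sh T a x = 0"
  then obtain m where m: "x = (sh T a ^^ p) m" using kM by blast
  then have "m \<in> ker (sh T a ^^ Suc p)" using x by (simp add: ker_def)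
  then have "m \<in> ker (sh T a ^^ p)" by (simp only: p)
  then show "x = 0" by (simp add: ker_def m)
qed

text \<open>On \<open>M\<close> the Kato condition puts every vector killed by a power of the
  operator into its range. Stable ranges solve \<open>(?S ^^ q) y = (?S ^^ Suc q) z\<close>; for
  \<open>z = m + n\<close> the vector \<open>(?S ^^ q) (y - ?S m)\<close> lies in both
  \<open>M\<close> and \<open>N\<close>, so it vanishes and \<open>y - ?S m\<close> is such a
  vector.\<close>

lemma finite_descent_imp_surjective:
  assumes kM: "\<And>n x. x \<in> M \<Longrightarrow> sh T a x = 0 \<Longrightarrow> x \<in> (sh T a ^^ n) ` M" and "finite_descent (sh T a)"
  shows "\<beta> M a = 0"
proof -
  let ?S = "sh T a"
  have lin: "linear (?S ^^ n)" for n by (rule is_op_linear[OF is_op_funpow[OF is_op_sh]])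
  have sR: "subspace (?S ` M)" by (rule linear_subspace_image[OF is_op_linear[OF is_op_sh] subspace_M])
  have nil: "\<forall>x\<in>M. (?S ^^ j) x = 0 \<longrightarrow> x \<in> ?S ` M" for j
  proof (induction j)
    case 0
    show ?case using subspace_0[OF sR] by simp
  next
    case (Suc j)
    show ?case
    proof (intro ballI impI)
      fix x assume x: "x \<in> M" "(?S ^^ Suc j) x = 0"
      have "(?S ^^ j) x \<in> M" using x(1) shift_funpow_M by blast
      moreover have "?S ((?S ^^ j) x) = 0" using x(2) by simp
      \<comment> \<open>The kernel vector is lifted by one power more than \<open>j\<close>, so that
        \<open>x - ?S u\<close> is killed by the \<open>j\<close>-th power and the induction
        hypothesis applies.\<close>
      ultimately have "(?S ^^ j) x \<in> (?S ^^ Suc j) ` M" by (rule kM)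
      then obtain u where u: "u \<in> M" "(?S ^^ j) x = (?S ^^ Suc j) u" by (rule imageE)
      have "(?S ^^ j) (x - ?S u) = 0" using u(2) by (simp add: linear_diff[OF lin] funpow_swap1)
      moreover have Su: "?S u \<in> ?S ` M" using u(1) by (rule imageI)
      moreover have "x - ?S u \<in> M" using x(1) Su shift_M by (intro subspace_diff[OF subspace_M]) auto
      ultimately have "x - ?S u \<in> ?S ` M" using Suc by blast
      from subspace_add[OF sR this Su] show "x \<in> ?S ` M" by simp
    qed
  qed
  obtain q where q: "range (?S ^^ q) = range (?S ^^ Suc q)" using assms(2) by (auto simp: finite_descent_def)
  have "y \<in> ?S ` M" if y: "y \<in> M" for y
  proof -
    have "(?S ^^ q) y \<in> range (?S ^^ Suc q)" unfolding q[symmetric] by (rule rangeI)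
    then obtain z where z: "(?S ^^ q) y = (?S ^^ Suc q) z" by (rule imageE)
    obtain m n where mn: "m \<in> M" "n \<in> N" "z = m + n" using split by blast
    have "?S m \<in> ?S ` M" using mn(1) by (rule imageI)
    then have ym: "y - ?S m \<in> M" using y shift_M by (intro subspace_diff[OF subspace_M]) auto
    have "(?S ^^ q) (y - ?S m) = (?S ^^ Suc q) n"
      using z by (simp add: mn(3) linear_diff[OF lin] linear_add[OF lin] funpow_swap1
          linear_add[OF is_op_linear[OF is_op_sh]] del: funpow.simps add: funpow_Suc_right)
    moreover have "(?S ^^ q) (y - ?S m) \<in> M" using ym shift_funpow_M by blast
    moreover have "(?S ^^ Suc q) n \<in> N" using mn(2) shift_funpow_N by blast
    ultimately have "(?S ^^ q) (y - ?S m) = 0" using MN by auto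
    then have "y - ?S m \<in> ?S ` M" using nil ym by blast
    from subspace_add[OF sR this \<open>?S m \<in> ?S ` M\<close>] show ?thesis by simp
  qed
  then have "?S ` M = M" using shift_M by blast
  then show ?thesis using range_full_iff[OF is_op_sh subspace_M shift_M] by blast
qed

lemma finite_ascentI:
  assumes "\<alpha> M a = 0" "a \<noteq> 0"
  shows "finite_ascent (sh T a)"
proof -
  let ?S = "sh T a"
  obtain p where p: "\<And>x. x \<in> N \<Longrightarrow> (?S ^^ Suc p) x = 0 \<Longrightarrow> (?S ^^ p) x = 0"
    using riesz_part(4)[OF assms(2)] by blast
  have inj: "x \<in> M \<Longrightarrow> ?S x = 0 \<Longrightarrow> x = 0" for x using assms(1) kernel_zero_iff[OF is_op_sh] by blast
  have injp: "\<forall>x\<in>M. (?S ^^ j) x = 0 \<longrightarrow> x = 0" for j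
  proof (induction j)
    case (Suc j)
    show ?case
    proof (intro ballI impI)
      fix x assume x: "x \<in> M" "(?S ^^ Suc j) x = 0"
      then have "?S x \<in> M" "(?S ^^ j) (?S x) = 0" using shift_M by (auto simp: funpow_swap1)
      then show "x = 0" using Suc inj x(1) by blast
    qed
  qed simp
  have lin: "linear (?S ^^ n)" for n by (rule is_op_linear[OF is_op_funpow[OF is_op_sh]])
  have "ker (?S ^^ p) = ker (?S ^^ Suc p)"
  proof
    show "ker (?S ^^ p) \<subseteq> ker (?S ^^ Suc p)" using linear_0[OF is_op_linear[OF is_op_sh]] by (auto simp: ker_def)
    show "ker (?S ^^ Suc p) \<subseteq> ker (?S ^^ p)"
    proof
      fix x assume x: "x \<in> ker (?S ^^ Suc p)"
      obtain m n where mn: "m \<in> M" "n \<in> N" "x = m + n" using split by blast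
      have "(?S ^^ Suc p) (m + n) = 0" using x mn(3) by (simp add: ker_def)
      note components_zero_image[OF lin shift_funpow_M shift_funpow_N mn(1,2) this]
      then have "m = 0" "(?S ^^ p) n = 0" using injp mn(1) p mn(2) by blast+
      then show "x \<in> ker (?S ^^ p)" using mn(3) by (simp add: ker_def)
    qed
  qed
  then show ?thesis unfolding finite_ascent_def by blast
qed

lemma finite_descentI:
  assumes "\<beta> M a = 0" "a \<noteq> 0"
  shows "finite_descent (sh T a)"
proof -
  let ?S = "sh T a"
  obtain p where p: "(?S ^^ Suc p) ` N = (?S ^^ p) ` N" using riesz_part(4)[OF assms(2)] by blast
  have "?S ` M = M" using assms(1) range_full_iff[OF is_op_sh subspace_M shift_M] by blast
  then have Mj: "(?S ^^ j) ` M = M" for j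
    by (induction j) (simp_all add: funpow_Suc_image(1) del: funpow.simps(2))
  have "range (?S ^^ p) = range (?S ^^ Suc p)"
    unfolding range_split[OF is_op_linear[OF is_op_funpow[OF is_op_sh]]] p Mj ..
  then show ?thesis unfolding finite_descent_def by blast
qed

lemma in_class_imp_restricted:
  assumes kM: "\<And>n x. x \<in> M \<Longrightarrow> sh T a x = 0 \<Longrightarrow> x \<in> (sh T a ^^ n) ` M" and R: "in_class R (sh T a)"
  shows "restricted_class R (\<alpha> M a) (\<beta> M a)"
proof -
  \<comment> \<open>The part on \<open>N\<close> adds the same number to nullity and defect; it can
    be cancelled in \<open>enat\<close> because it is finite.\<close>
  have cancel: "x + c \<le> y + c \<Longrightarrow> c \<noteq> \<infinity> \<Longrightarrow> x \<le> y" for x y c :: enat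
    by (cases x; cases y; cases c) auto
  have cancel': "x + c = y + c \<Longrightarrow> c \<noteq> \<infinity> \<Longrightarrow> x = y" for x y c :: enat
    by (cases x; cases y; cases c) auto
  note asc = finite_ascent_imp_injective[OF kM] and desc = finite_descent_imp_surjective[OF kM]
  note iffs = upper_semi_fredholm_iff[OF is_op_sh] lower_semi_fredholm_iff fredholm_def
    weyl_upper_iff[OF is_op_sh] weyl_lower_iff[OF is_op_sh] weyl_iff[OF is_op_sh]
  note rp = riesz_part_semi_fredholm
  show ?thesis
  proof (cases R)
    case B_plus
    then show ?thesis using R asc by (simp add: browder_upper_def)
  next
    case B_minus
    then show ?thesis using R desc by (simp add: browder_lower_def)
  next
    case B_class
    then show ?thesis using R asc desc by (simp add: browder_def)
  next
    case Phi_plus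
    then show ?thesis using R by (simp add: iffs ker_sum plus_eq_infty_iff_enat)
  next
    case Phi_minus
    then show ?thesis using R by (simp add: iffs range_sum plus_eq_infty_iff_enat)
  next
    case Phi_class
    then show ?thesis using R by (simp add: iffs ker_sum range_sum plus_eq_infty_iff_enat)
  next
    case W_plus
    then have w: "rdim {0} (ker (sh T a)) \<noteq> \<infinity>" "closed (range (sh T a))"
      "rdim {0} (ker (sh T a)) \<le> rdim (range (sh T a)) UNIV" using R by (auto simp: iffs)
    then have n: "\<alpha> N a = \<beta> N a" "\<beta> N a \<noteq> \<infinity>" using rp[of a] by blast+
    have "\<alpha> M a \<le> \<beta> M a" using cancel[OF _ n(2)] w(3) unfolding ker_sum range_sum n(1) by blast
    moreover have "\<alpha> M a \<noteq> \<infinity>" using w(1) unfolding ker_sum by (simp add: plus_eq_infty_iff_enat)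
    ultimately show ?thesis using W_plus by simp
  next
    case W_minus
    then have w: "rdim (range (sh T a)) UNIV \<noteq> \<infinity>"
      "rdim (range (sh T a)) UNIV \<le> rdim {0} (ker (sh T a))" using R by (auto simp: iffs)
    then have n: "\<alpha> N a = \<beta> N a" "\<beta> N a \<noteq> \<infinity>" using rp[of a] by blast+
    have "\<beta> M a \<le> \<alpha> M a" using cancel[OF _ n(2)] w(2) unfolding ker_sum range_sum n(1) by blast
    moreover have "\<beta> M a \<noteq> \<infinity>" using w(1) unfolding range_sum by (simp add: plus_eq_infty_iff_enat)
    ultimately show ?thesis using W_minus by simp
  next
    case W_class
    then have w: "rdim {0} (ker (sh T a)) \<noteq> \<infinity>" "closed (range (sh T a))"
      "rdim {0} (ker (sh T a)) = rdim (range (sh T a)) UNIV" using R by (auto simp: iffs)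
    then have n: "\<alpha> N a = \<beta> N a" "\<beta> N a \<noteq> \<infinity>" using rp[of a] by blast+
    have "\<alpha> M a = \<beta> M a" using cancel'[OF _ n(2)] w(3) unfolding ker_sum range_sum n(1) by blast
    moreover from this have "\<beta> M a \<noteq> \<infinity>" using w(1) unfolding ker_sum by (simp add: plus_eq_infty_iff_enat)
    ultimately show ?thesis using W_class by simp
  qed
qed

text \<open>For \<open>a \<noteq> 0\<close> the part on \<open>N\<close> has closed range, finite
  nullity equal to its defect, and stable kernels and ranges, so the part on \<open>M\<close> alone
  decides.\<close>

lemma restricted_imp_in_class:
  assumes cl: "closed (sh T a ` M)" and a: "a \<noteq> 0" and R: "restricted_class R (\<alpha> M a) (\<beta> M a)"
  shows "in_class R (sh T a)"
proof -
  note n = riesz_part(1-3)[OF a]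
  have clr: "closed (range (sh T a))" using closed_range cl n(1) by blast
  note iffs = upper_semi_fredholm_iff[OF is_op_sh] lower_semi_fredholm_iff fredholm_def
    weyl_upper_iff[OF is_op_sh] weyl_lower_iff[OF is_op_sh] weyl_iff[OF is_op_sh] ker_sum range_sum n(2) plus_eq_infty_iff_enat
  show ?thesis
    using R n(3) clr finite_ascentI[OF _ a] finite_descentI[OF _ a]
    by (cases R)
       (simp_all add: iffs browder_upper_def browder_lower_def browder_def add_right_mono
          del: not_infinity_eq)
qed

text \<open>Passing from a class to nullity and defect works at \<open>a = 0\<close> too; the way
  back excludes 0, where the part on \<open>N\<close> need not be Fredholm.\<close>

lemma punctured_disc:
  obtains \<epsilon> where "\<epsilon> > 0"
    "\<And>R a. cmod a < \<epsilon> \<Longrightarrow> in_class R (sh T a) \<Longrightarrow> restricted_class R (\<alpha> M 0) (\<beta> M 0)"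
    "\<And>a. cmod a < \<epsilon> \<Longrightarrow> \<alpha> M a = \<alpha> M 0 \<and> \<beta> M a = \<beta> M 0"
    "\<And>R a. cmod a < \<epsilon> \<Longrightarrow> a \<noteq> 0 \<Longrightarrow> restricted_class R (\<alpha> M 0) (\<beta> M 0) \<Longrightarrow> in_class R (sh T a)"
proof -
  obtain \<epsilon> where \<epsilon>: "\<epsilon> > 0"
    and cl: "\<And>a. cmod a < \<epsilon> \<Longrightarrow> closed (sh T a ` M)"
    and kM: "\<And>a n x. cmod a < \<epsilon> \<Longrightarrow> x \<in> M \<Longrightarrow> sh T a x = 0 \<Longrightarrow> x \<in> (sh T a ^^ n) ` M"
    and k: "\<And>a b. cmod a < \<epsilon> \<Longrightarrow> cmod b < \<epsilon> \<Longrightarrow> \<alpha> M a = \<alpha> M b"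
    and r: "\<And>a b. cmod a < \<epsilon> \<Longrightarrow> cmod b < \<epsilon> \<Longrightarrow> \<beta> M a = \<beta> M b"
    by (rule kato_stable[OF T M kato]) blast
  have z: "cmod 0 < \<epsilon>" using \<epsilon> by simp
  show ?thesis
  proof (rule that[OF \<epsilon>])
    show "restricted_class R (\<alpha> M 0) (\<beta> M 0)" if "cmod a < \<epsilon>" "in_class R (sh T a)" for R a
      using in_class_imp_restricted[OF kM[OF that(1)] that(2)] unfolding k[OF that(1) z] r[OF that(1) z] .
    show "\<alpha> M a = \<alpha> M 0 \<and> \<beta> M a = \<beta> M 0" if "cmod a < \<epsilon>" for a
      using k[OF that z] r[OF that z] by blast
    show "in_class R (sh T a)" if "cmod a < \<epsilon>" "a \<noteq> 0" "restricted_class R (\<alpha> M 0) (\<beta> M 0)" for R a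
      by (rule restricted_imp_in_class[OF cl[OF that(1)] that(2)])
         (use that(3) in \<open>simp only: k[OF that(1) z] r[OF that(1) z]\<close>)
  qed
qed

section \<open>Boundary points of the spectra\<close>

lemma bounded_below_imp_injective: "bounded_below (sh T a) \<Longrightarrow> \<alpha> M a = 0"
proof -
  assume "bounded_below (sh T a)"
  then obtain c where "c > 0" and c: "\<And>x. c * norm x \<le> norm (sh T a x)" by (auto simp: bounded_below_def)
  have "x = 0" if "sh T a x = 0" for x
    using c[of x] that \<open>c > 0\<close> by (simp add: mult_le_0_iff)
  then show ?thesis using kernel_zero_iff[OF is_op_sh] by blast
qed

lemma surj_imp_surjective: "surj (sh T a) \<Longrightarrow> \<beta> M a = 0"
proof -
  assume "surj (sh T a)"
  then have "rdim (range (sh T a)) UNIV = 0" by (simp add: rdim_eq_0_iff)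
  then show ?thesis unfolding range_sum by simp
qed

lemma bij_imp_injective: "bij (sh T a) \<Longrightarrow> \<alpha> M a = 0"
proof -
  assume "bij (sh T a)"
  then have "x = 0" if "sh T a x = 0" for x
    using injD[OF bij_is_inj, of "sh T a" x 0] that linear_0[OF is_op_linear[OF is_op_sh]] by simp
  then show ?thesis using kernel_zero_iff[OF is_op_sh] by blast
qed

lemma not_islimptI:
  assumes "\<epsilon> > 0" "\<And>a. cmod a < \<epsilon> \<Longrightarrow> a \<noteq> 0 \<Longrightarrow> in_class R (sh T a)"
  shows "\<not> 0 islimpt spec_R R scl T"
  unfolding islimpt_approachable spec_R_def using assms by (auto intro!: exI[of _ \<epsilon>])

lemma frontier_approx:
  assumes "0 \<in> frontier {\<mu>::complex. \<not> P \<mu>}" "\<epsilon> > 0"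
  obtains a where "cmod a < \<epsilon>" "P a"
proof -
  have "0 \<notin> interior {\<mu>. \<not> P \<mu>}" using assms(1) by (simp add: frontier_def)
  then have "\<not> ball 0 \<epsilon> \<subseteq> {\<mu>. \<not> P \<mu>}" using assms(2) by (auto simp: mem_interior)
  then show ?thesis using that by auto
qed

lemma frontier_imp_isolated:
  assumes fr: "0 \<in> frontier (spec_R R scl T)"
  shows "0 \<in> iso_pts (spec_R R scl T)"
proof -
  obtain \<epsilon> where \<epsilon>: "\<epsilon> > 0"
    and fwd: "\<And>R a. cmod a < \<epsilon> \<Longrightarrow> in_class R (sh T a) \<Longrightarrow> restricted_class R (\<alpha> M 0) (\<beta> M 0)"
    and bwd: "\<And>R a. cmod a < \<epsilon> \<Longrightarrow> a \<noteq> 0 \<Longrightarrow> restricted_class R (\<alpha> M 0) (\<beta> M 0) \<Longrightarrow> in_class R (sh T a)"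
    by (rule punctured_disc) blast
  obtain a where "cmod a < \<epsilon>" "in_class R (sh T a)"
    using frontier_approx[OF _ \<epsilon>, of "\<lambda>\<mu>. in_class R (sh T \<mu>)"] fr unfolding spec_R_def by blast
  then have "restricted_class R (\<alpha> M 0) (\<beta> M 0)" by (rule fwd)
  then have "\<not> 0 islimpt spec_R R scl T" using \<epsilon> bwd by (intro not_islimptI) blast+
  \<comment> \<open>A point of the closure that is not a limit point belongs to the set
    itself.\<close>
  moreover have "0 \<in> closure (spec_R R scl T)" using fr by (simp add: frontier_def)
  ultimately show ?thesis by (auto simp: iso_pts_def closure_def)
qed

text \<open>\<open>P\<close> stands for being bounded below, surjective or bijective. It yields
  information only at the approximating point; constancy on the disc transfers the resulting nullity
  or defect to 0.\<close>

lemma not_acc_of_approximant: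
  assumes fr: "0 \<in> frontier {\<mu>. \<not> P \<mu>}"
    and P: "\<And>a. P a \<Longrightarrow> restricted_class R (\<alpha> M a) (\<beta> M a)"
  shows "0 \<notin> acc_pts (spec_R R scl T)"
proof -
  obtain \<epsilon> where \<epsilon>: "\<epsilon> > 0"
    and const: "\<And>a. cmod a < \<epsilon> \<Longrightarrow> \<alpha> M a = \<alpha> M 0 \<and> \<beta> M a = \<beta> M 0"
    and bwd: "\<And>R a. cmod a < \<epsilon> \<Longrightarrow> a \<noteq> 0 \<Longrightarrow> restricted_class R (\<alpha> M 0) (\<beta> M 0) \<Longrightarrow> in_class R (sh T a)"
    by (rule punctured_disc) blast
  obtain a where "cmod a < \<epsilon>" "P a" using frontier_approx[OF fr \<epsilon>] by blast
  then have "restricted_class R (\<alpha> M 0) (\<beta> M 0)" using P[of a] const[of a] by simp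
  then have "\<not> 0 islimpt spec_R R scl T" using \<epsilon> bwd by (intro not_islimptI) blast+
  then show ?thesis by (simp add: acc_pts_def)
qed

end

theorem theorem3p14:
  fixes scl :: "complex \<Rightarrow> 'a::banach \<Rightarrow> 'a" and T :: "'a \<Rightarrow> 'a"
  assumes "complex_structure scl"
    and "infinite_dimensional TYPE('a)"
    and "is_op scl T"
  shows "(\<forall>R. 0 \<in> frontier (spec_R R scl T) \<and> GKRD scl T \<longrightarrow> 0 \<in> iso_pts (spec_R R scl T)) \<and>
         (GKRD scl T \<longrightarrow>
            (0 \<in> frontier (spec_ap scl T) \<longrightarrow> 0 \<notin> acc_pts (spec_R B_plus scl T)) \<and>
            (0 \<in> frontier (spec_su scl T) \<longrightarrow> 0 \<notin> acc_pts (spec_R B_minus scl T)) \<and>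
            (0 \<in> frontier (spectrum scl T) \<longrightarrow> 0 \<notin> acc_pts (spec_R B_class scl T)))"
proof (cases "GKRD scl T")
  case True
  then obtain M N where MN: "closed M" "closed N" "csubspace scl M" "csubspace scl N"
     "T ` M \<subseteq> M" "T ` N \<subseteq> N" "M \<inter> N = {0}" "\<forall>x. \<exists>m\<in>M. \<exists>n\<in>N. x = m + n"
     "kato_on M T" "riesz_on scl N T"
    unfolding GKRD_def by blast
  interpret gkrd scl T M N
    by (intro gkrd.intro complex_banach.intro gkrd_axioms.intro assms(1,3) MN(1-7,9,10) MN(8)[rule_format])
  have "0 \<notin> acc_pts (spec_R B_plus scl T)" if "0 \<in> frontier (spec_ap scl T)"
    using that unfolding spec_ap_def
    by (rule not_acc_of_approximant) (simp add: bounded_below_imp_injective)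
  moreover have "0 \<notin> acc_pts (spec_R B_minus scl T)" if "0 \<in> frontier (spec_su scl T)"
    using that unfolding spec_su_def
    by (rule not_acc_of_approximant) (simp add: surj_imp_surjective)
  moreover have "0 \<notin> acc_pts (spec_R B_class scl T)" if "0 \<in> frontier (spectrum scl T)"
    using that unfolding spectrum_def
    by (rule not_acc_of_approximant) (simp add: bij_imp_injective surj_imp_surjective bij_is_surj)
  ultimately show ?thesis using frontier_imp_isolated by blast
qed simp

end
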